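(* Let $\alpha_0,\alpha_1,\alpha_2,\eta$ be complex parameters with $\alpha_0+\alpha_1+\alpha_2=1$. Consider an ordinary differential system in the polynomial class $$\frac{dx}{dt}=f_1(x,y,z,w,q),\quad \frac{dy}{dt}=f_2(x,y,z,w,q),\quad \frac{dz}{dt}=f_3(x,y,z,w,q),\quad \frac{dw}{dt}=f_4(x,y,z,w,q),\quad \frac{dq}{dt}=f_5(x,y,z,w,q),$$ with $f_i\in\mathbb{C}(t)[x,y,z,w,q]$ for $i=1,\dots,5$. Assume: (A1) $\deg(f_i)=3$ with respect to $x,y,z,w,q$. (A2) The right-hand side of this system becomes again a polynomial in each of the following coordinate systems $(x_i,y_i,z_i,w_i,q_i)$, $i=0,1,2$: $$0)\quad x_0=x,\quad y_0=y-\frac{2\alpha_0 w}{z}+\frac{\eta w}{z^2},\quad z_0=z,\quad w_0=w,\quad q_0=q-\frac{2\alpha_0}{z}+\frac{\eta}{z^2};$$ $$1)\quad x_1=x+\frac{\alpha_1 q}{y},\quad y_1=y,\quad z_1=z+\frac{\alpha_1 w}{y},\quad w_1=w,\quad q_1=q;$$ $$2)\quad x_2=x,\quad y_2=y-\frac{2\alpha_2 q}{x}-\frac{q}{x^2},\quad z_2=z,\quad w_2=w-\frac{2\alpha_2}{x}-\frac{1}{x^2},\quad q_2=q.$$ Then the system coincides with $$\begin{aligned} \frac{dx}{dt}&=-(xw-\alpha_2)x+\frac12,\\ \frac{dy}{dt}&=(xw+zq-1)y+\alpha_1 wq,\\ \frac{dz}{dt}&=-(zq-\alpha_0)z-\frac{\eta}{2},\\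 \frac{dw}{dt}&=(xw-zq-\alpha_2)w+yz,\\ \frac{dq}{dt}&=(zq-xw-\alpha_0)q+xy. \end{aligned}$$
   Context: Here $x,y,z,w,q$ are unknown complex functions of the complex variable $t$. Condition (A2) means: for each $i$, rewriting the system in the coordinates $(x_i,y_i,z_i,w_i,q_i)$ (a birational change of variables), each of $dx_i/dt,\dots,dq_i/dt$ is a polynomial in $x_i,y_i,z_i,w_i,q_i$ with coefficients in $\mathbb{C}(t)$.
   Formalization: The system is shown to coincide with the displayed one only up to a nonzero factor c(t) in C(t) (twice the displayed system also satisfies (A1), (A2)), and α_1 ≠ 0 and η ≠ 0 are assumed, since otherwise further systems satisfy (A1), (A2). *)

theory Defs
  imports "HOL-Library.Poly_Mapping" "HOL-Computational_Algebra.Computational_Algebra"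
begin

datatype coord = cX | cY | cZ | cW | cQ

lemma UNIV_coord: "(UNIV :: coord set) = {cX, cY, cZ, cW, cQ}"
  by (auto intro: coord.exhaust)

instance coord :: finite
  by intro_classes (simp add: UNIV_coord)

text \<open>
  The order on the coordinates carries no meaning; it is what the type class instance
  making the polynomial ring below an integral domain asks for.
\<close>

fun coord_index :: "coord \<Rightarrow> nat" where
  "coord_index cX = 0"
| "coord_index cY = 1"
| "coord_index cZ = 2"
| "coord_index cW = 3"
| "coord_index cQ = 4"

lemma coord_index_inject: "coord_index u = coord_index v \<longleftrightarrow> u = v"
  by (cases u; cases v) simp_all

instantiation coord :: linorder
begin

definition less_eq_coord :: "coord \<Rightarrow> coord \<Rightarrow> bool" where
  "u \<le> v \<longleftrightarrow> coord_index u \<le> coord_index v"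

definition less_coord :: "coord \<Rightarrow> coord \<Rightarrow> bool" where
  "u < v \<longleftrightarrow> coord_index u < coord_index v"

instance
  by intro_classes (auto simp: less_eq_coord_def less_coord_def simp flip: coord_index_inject)

end

text \<open>
  \<open>ratt\<close> is the field \<open>\<complex>(t)\<close>, \<open>pol\<close> the ring \<open>\<complex>(t)[x,y,z,w,q]\<close> and
  \<open>ratfun\<close> its field of fractions \<open>\<complex>(t)(x,y,z,w,q)\<close>.
\<close>

type_synonym ratt = "complex poly fract"
type_synonym pol = "(coord \<Rightarrow>\<^sub>0 nat) \<Rightarrow>\<^sub>0 ratt"
type_synonym ratfun = "pol fract"

definition const_t :: "complex \<Rightarrow> ratt" where
  "const_t c = Fract [:c:] 1"

definition time :: ratt where
  "time = Fract [:0, 1:] 1"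

definition Const :: "ratt \<Rightarrow> pol" where
  "Const a = Poly_Mapping.single 0 a"

definition Var :: "coord \<Rightarrow> pol" where
  "Var v = Poly_Mapping.single (Poly_Mapping.single v 1) 1"

definition tdegree :: "pol \<Rightarrow> nat" where
  "tdegree p = Max (insert 0 ((\<lambda>m. \<Sum>v\<in>UNIV. Poly_Mapping.lookup m v) ` Poly_Mapping.keys p))"

definition to_ratfun :: "pol \<Rightarrow> ratfun" where
  "to_ratfun p = Fract p 1"

text \<open>\<open>subst u g\<close> is \<open>g(u\<^sub>x, u\<^sub>y, u\<^sub>z, u\<^sub>w, u\<^sub>q)\<close>.\<close>

definition subst :: "(coord \<Rightarrow> ratfun) \<Rightarrow> pol \<Rightarrow> ratfun" where
  "subst u g = (\<Sum>m\<in>Poly_Mapping.keys g.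
     to_ratfun (Const (Poly_Mapping.lookup g m)) * (\<Prod>v\<in>UNIV. u v ^ Poly_Mapping.lookup m v))"

text \<open>
  The differential operator \<open>d/dt\<close> along the system \<open>dv/dt = f v\<close>, where \<open>v\<close> runs over
  \<open>x, y, z, w, q\<close>: the (unique) derivation of \<open>\<complex>(t)(x,y,z,w,q)\<close> over \<open>\<complex>\<close> with
  \<open>dt/dt = 1\<close> and \<open>dv/dt = f v\<close>.
\<close>

definition d_dt_along :: "(coord \<Rightarrow> pol) \<Rightarrow> (ratfun \<Rightarrow> ratfun) \<Rightarrow> bool" where
  "d_dt_along f D \<longleftrightarrow>
     (\<forall>a b. D (a + b) = D a + D b) \<and>
     (\<forall>a b. D (a * b) = D a * b + a * D b) \<and>
     (\<forall>c. D (to_ratfun (Const (const_t c))) = 0) \<and>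
     D (to_ratfun (Const time)) = 1 \<and>
     (\<forall>v. D (to_ratfun (Var v)) = to_ratfun (f v))"

text \<open>The right-hand sides, rewritten in the coordinates \<open>u\<close>, are polynomials over \<open>\<complex>(t)\<close>:
  \<open>du\<^sub>v/dt = g\<^sub>v(u)\<close>.\<close>

definition polynomial_in_coords :: "(ratfun \<Rightarrow> ratfun) \<Rightarrow> (coord \<Rightarrow> ratfun) \<Rightarrow> bool" where
  "polynomial_in_coords D u \<longleftrightarrow> (\<forall>v. \<exists>g :: pol. D (u v) = subst u g)"

text \<open>
  The coordinate changes below have coefficients in \<open>\<complex>\<close>, so \<open>d/dt\<close> of the new coordinates is
  \<open>\<complex>(t)\<close>-linear in the right-hand side \<open>f\<close>: \<open>f\<close> may be multiplied by any nonzero \<open>c(t)\<close>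
  (a rescaling \<open>c(t) dt\<close> of the time) without affecting polynomiality.  Moreover \<open>coords1\<close> is
  the identity for \<open>\<alpha>\<^sub>1 = 0\<close>, and for \<open>\<eta> = 0\<close> polynomiality is also preserved on adding
  \<open>(0, y, -z, 0, q)\<close> to \<open>f\<close>.  Hence a system is characterised by its polynomiality in these
  coordinates only up to \<open>c(t)\<close>, and only for \<open>\<alpha>\<^sub>1 \<noteq> 0\<close> and \<open>\<eta> \<noteq> 0\<close>.
\<close>

abbreviation rc :: "complex \<Rightarrow> ratfun" where
  "rc c \<equiv> to_ratfun (Const (const_t c))"

abbreviation rv :: "coord \<Rightarrow> ratfun" where
  "rv v \<equiv> to_ratfun (Var v)"

fun coords0 :: "complex \<Rightarrow> complex \<Rightarrow> coord \<Rightarrow> ratfun" where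
  "coords0 \<alpha>\<^sub>0 \<eta> cX = rv cX"
| "coords0 \<alpha>\<^sub>0 \<eta> cY = rv cY - rc (2 * \<alpha>\<^sub>0) * rv cW / rv cZ + rc \<eta> * rv cW / rv cZ ^ 2"
| "coords0 \<alpha>\<^sub>0 \<eta> cZ = rv cZ"
| "coords0 \<alpha>\<^sub>0 \<eta> cW = rv cW"
| "coords0 \<alpha>\<^sub>0 \<eta> cQ = rv cQ - rc (2 * \<alpha>\<^sub>0) / rv cZ + rc \<eta> / rv cZ ^ 2"

fun coords1 :: "complex \<Rightarrow> coord \<Rightarrow> ratfun" where
  "coords1 \<alpha>\<^sub>1 cX = rv cX + rc \<alpha>\<^sub>1 * rv cQ / rv cY"
| "coords1 \<alpha>\<^sub>1 cY = rv cY"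
| "coords1 \<alpha>\<^sub>1 cZ = rv cZ + rc \<alpha>\<^sub>1 * rv cW / rv cY"
| "coords1 \<alpha>\<^sub>1 cW = rv cW"
| "coords1 \<alpha>\<^sub>1 cQ = rv cQ"

fun coords2 :: "complex \<Rightarrow> coord \<Rightarrow> ratfun" where
  "coords2 \<alpha>\<^sub>2 cX = rv cX"
| "coords2 \<alpha>\<^sub>2 cY = rv cY - rc (2 * \<alpha>\<^sub>2) * rv cQ / rv cX - rv cQ / rv cX ^ 2"
| "coords2 \<alpha>\<^sub>2 cZ = rv cZ"
| "coords2 \<alpha>\<^sub>2 cW = rv cW - rc (2 * \<alpha>\<^sub>2) / rv cX - 1 / rv cX ^ 2"
| "coords2 \<alpha>\<^sub>2 cQ = rv cQ"

end

theory Submission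
  imports Defs "HOL-Library.Function_Algebras"
begin

text \<open>
  Each of the three coordinate changes has the form \<open>v \<mapsto> v - k \<cdot> \<delta> v\<close>, where \<open>k = b/e + g/e\<^sup>2\<close>
  has its pole along \<open>e = 0\<close> for one coordinate \<open>e\<close>, and \<open>\<delta>\<close> is non-zero on two other
  coordinates only:
  \<^item> chart 0: \<open>e = z\<close>, \<open>\<delta> y = w\<close>, \<open>\<delta> q = 1\<close>, with \<open>b = 2 \<alpha>\<^sub>0\<close> and \<open>g = -\<eta>\<close>;
  \<^item> chart 1: \<open>e = y\<close>, \<open>\<delta> x = q\<close>, \<open>\<delta> z = w\<close>, with \<open>b = -\<alpha>\<^sub>1\<close> and \<open>g = 0\<close>;
  \<^item> chart 2: \<open>e = x\<close>, \<open>\<delta> y = q\<close>, \<open>\<delta> w = 1\<close>, with \<open>b = 2 \<alpha>\<^sub>2\<close> and \<open>g = 1\<close>.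

  As \<open>\<delta>\<close> annihilates \<open>e\<close> and its own values, the old coordinates are \<open>v + k \<cdot> \<delta> v\<close> in terms of
  the new ones: they are Laurent polynomials. The product rule turns polynomiality in a chart
  into the condition that
    \<open>f\<^sub>v - k \<cdot> f\<^bsub>\<delta> v\<^esub> - k' \<cdot> \<delta> v \<cdot> f\<^sub>e\<close>,
  rewritten in the new coordinates, has no negative powers of \<open>e\<close>, for every \<open>v\<close> (lemma
  \<open>regular\<close>; here \<open>f\<^bsub>\<delta> v\<^esub>\<close> is the derivative of \<open>\<delta> v\<close>). Rewriting is Taylor expansion along \<open>\<delta>\<close>,
  which stops after the third power of \<open>k\<close> because \<open>deg f \<le> 3\<close> (\<open>lookup_laur_eval_old_coord\<close>).
  So the hypothesis becomes a homogeneous linear system for the coefficients of \<open>f\<close>, and the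
  task is to see that its solutions form a line.

  Where \<open>\<delta> v = 0\<close>, the condition concerns \<open>f\<^sub>v\<close> alone, and it leaves few cubics
  (\<open>cubic_regular_subst_yw\<close> and \<open>cubic_regular_subst_xz\<close>). In chart 2, where \<open>u = y - q w\<close> is
  unchanged, they are spanned by the polynomials in \<open>x, z, q\<close>, by \<open>u \<cdot> {1, x, z, q}\<close> and by
  \<open>x\<^sup>2 w\<close>, \<open>x\<^sup>2 y\<close>; chart 0 is chart 2 with \<open>x, w\<close> and \<open>z, q\<close> exchanged. This pins down the
  shape of each \<open>f\<^sub>v\<close>. The condition for \<open>v = w\<close> in chart 2 ties \<open>f\<^sub>x\<close> to \<open>f\<^sub>w\<close> (\<open>shape_xw\<close>),
  and by the symmetry also \<open>f\<^sub>z\<close> to \<open>f\<^sub>q\<close>; chart 1 links these two halves through \<open>f\<^sub>y\<close>, and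
  together with the condition for \<open>v = y\<close> in chart 2 it leaves a single free coefficient \<open>k\<close>
  (\<open>coefficients\<close>). It is non-zero, since the right-hand sides have degree 3.
\<close>

section \<open>Constants and rational functions\<close>

text \<open>
  The linear system has to be solved over \<open>\<complex>(t)\<close>, dividing by \<open>2\<close> and \<open>3\<close>.
\<close>

instance fract :: ("{idom, ring_char_0}") ring_char_0
proof
  show "inj (of_nat :: nat \<Rightarrow> 'a fract)"
    by (rule injI) (simp add: of_nat_fract eq_fract)
qed

instance fract :: ("{idom, ring_char_0}") field_char_0 ..

lemma to_ratfun_simps:
  "to_ratfun (p + r) = to_ratfun p + to_ratfun r"
  "to_ratfun (p - r) = to_ratfun p - to_ratfun r"
  "to_ratfun (p * r) = to_ratfun p * to_ratfun r"
  "to_ratfun (- p) = - to_ratfun p"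
  "to_ratfun 0 = 0" "to_ratfun 1 = 1"
  by (simp_all add: to_ratfun_def Zero_fract_def One_fract_def)

lemma to_ratfun_power: "to_ratfun (p ^ n) = to_ratfun p ^ n"
  by (induction n) (simp_all add: to_ratfun_simps)

lemma to_ratfun_eq_iff: "to_ratfun p = to_ratfun r \<longleftrightarrow> p = r"
  by (simp add: to_ratfun_def eq_fract)

lemma const_t_simps:
  "const_t (a + b) = const_t a + const_t b"
  "const_t (a - b) = const_t a - const_t b"
  "const_t (a * b) = const_t a * const_t b"
  "const_t (- a) = - const_t a"
  "const_t 0 = 0" "const_t 1 = 1"
  by (simp_all add: const_t_def Zero_fract_def One_fract_def one_pCons mult_ac)

lemma const_t_eq_0_iff: "const_t a = 0 \<longleftrightarrow> a = 0"
  by (simp add: const_t_def Zero_fract_def eq_fract)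

lemma const_t_numeral: "const_t (numeral k) = numeral k"
proof -
  have "const_t (of_nat n) = of_nat n" for n
    by (induction n) (simp_all add: const_t_simps)
  from this[of "numeral k"] show ?thesis by simp
qed

lemma Const_simps:
  "Const (a + b) = Const a + Const b"
  "Const (a - b) = Const a - Const b"
  "Const (a * b) = Const a * Const b"
  "Const (- a) = - Const a"
  "Const 0 = 0" "Const 1 = 1"
  by (simp_all add: Const_def single_add single_diff single_uminus mult_single)

section \<open>Laurent polynomials\<close>

type_synonym expo = "coord \<Rightarrow> int"
type_synonym laur = "expo \<Rightarrow>\<^sub>0 ratt"

definition mon :: "expo \<Rightarrow> laur" where
  "mon \<mu> = Poly_Mapping.single \<mu> 1"

definition scal :: "ratt \<Rightarrow> laur" where
  "scal c = Poly_Mapping.single 0 c"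

definition unit_expo :: "coord \<Rightarrow> expo" where
  "unit_expo v = (\<lambda>u. if u = v then 1 else 0)"

lemma mon_add: "mon (\<mu> + \<nu>) = mon \<mu> * mon \<nu>"
  by (simp add: mon_def mult_single)

lemma mon_0: "mon 0 = 1"
  by (simp add: mon_def)

lemma mon_power: "mon \<mu> ^ n = mon (\<lambda>v. int n * \<mu> v)"
proof (induction n)
  case 0
  then show ?case by (simp add: mon_def zero_fun_def flip: single_one)
next
  case (Suc n)
  then show ?case
    by (simp add: mon_def mult_single plus_fun_def algebra_simps)
qed

lemma scal_simps:
  "scal (a + b) = scal a + scal b"
  "scal (a - b) = scal a - scal b"
  "scal (a * b) = scal a * scal b"
  "scal (- a) = - scal a"
  "scal 0 = 0" "scal 1 = 1"
  by (simp_all add: scal_def single_add single_diff single_uminus mult_single)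

lemma lookup_scal_mon_mult:
  "Poly_Mapping.lookup (scal c * mon \<nu> * l) \<mu> = c * Poly_Mapping.lookup l (\<mu> - \<nu>)"
proof -
  have "scal c * mon \<nu> = Poly_Mapping.single \<nu> c"
    by (simp add: scal_def mon_def mult_single)
  moreover have "(\<mu> = \<nu> + k) = (k = \<mu> - \<nu>)" for k :: expo
    by (auto simp: algebra_simps)
  ultimately show ?thesis
    by (simp add: lookup_mult lookup_single when_mult mult_when Sum_any_left_distrib
        flip: Sum_any_right_distrib)
qed

text \<open>
  A Laurent polynomial is a finitely supported function on integer exponents. Evaluating
  polynomials at Laurent polynomials is a ring homomorphism into a ring where monomials are
  units.
\<close>

definition laur_eval :: "(coord \<Rightarrow> laur) \<Rightarrow> pol \<Rightarrow> laur" where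
  "laur_eval s p = (\<Sum>m\<in>Poly_Mapping.keys p.
     scal (Poly_Mapping.lookup p m) * (\<Prod>v\<in>UNIV. s v ^ Poly_Mapping.lookup m v))"

lemma laur_eval_superset:
  assumes "finite S" "Poly_Mapping.keys p \<subseteq> S"
  shows "laur_eval s p = (\<Sum>m\<in>S. scal (Poly_Mapping.lookup p m) *
      (\<Prod>v\<in>UNIV. s v ^ Poly_Mapping.lookup m v))"
  unfolding laur_eval_def using assms
  by (intro sum.mono_neutral_left) (auto simp: in_keys_iff scal_simps)

lemma laur_eval_add: "laur_eval s (p + r) = laur_eval s p + laur_eval s r"
proof -
  let ?S = "Poly_Mapping.keys p \<union> Poly_Mapping.keys r"
  have "Poly_Mapping.keys (p + r) \<subseteq> ?S" by (rule keys_add)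
  then show ?thesis
    by (simp add: laur_eval_superset[of ?S] lookup_add scal_simps distrib_right sum.distrib)
qed

lemma laur_eval_0: "laur_eval s 0 = 0" by (simp add: laur_eval_def)

lemma laur_eval_single: "laur_eval s (Poly_Mapping.single m c)
    = scal c * (\<Prod>v\<in>UNIV. s v ^ Poly_Mapping.lookup m v)"
  by (cases "c = 0") (simp_all add: laur_eval_def scal_simps)

lemma laur_eval_sum: "laur_eval s (\<Sum>i\<in>I. p i) = (\<Sum>i\<in>I. laur_eval s (p i))"
  by (induction I rule: infinite_finite_induct) (simp_all add: laur_eval_0 laur_eval_add)

lemma sum_single_lookup:
  "p = (\<Sum>m\<in>Poly_Mapping.keys p. Poly_Mapping.single m (Poly_Mapping.lookup p m))"
proof (rule poly_mapping_eqI)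
  fix k
  show "Poly_Mapping.lookup p k
      = Poly_Mapping.lookup (\<Sum>m\<in>Poly_Mapping.keys p. Poly_Mapping.single m
          (Poly_Mapping.lookup p m)) k"
    by (cases "k \<in> Poly_Mapping.keys p")
       (auto simp: lookup_sum lookup_single when_def in_keys_iff sum.delta)
qed

lemma laur_eval_single_mult: "laur_eval s (Poly_Mapping.single m c * Poly_Mapping.single n d)
    = laur_eval s (Poly_Mapping.single m c) * laur_eval s (Poly_Mapping.single n d)"
  by (simp add: mult_single laur_eval_single scal_simps lookup_add power_add prod.distrib mult_ac)

lemma laur_eval_mult: "laur_eval s (p * r) = laur_eval s p * laur_eval s r"
proof -
  have "laur_eval s (p * r) = laur_eval s ((\<Sum>m\<in>Poly_Mapping.keys p. Poly_Mapping.single m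
      (Poly_Mapping.lookup p m))
      * (\<Sum>m\<in>Poly_Mapping.keys r. Poly_Mapping.single m (Poly_Mapping.lookup r m)))"
    by (simp flip: sum_single_lookup)
  also have "\<dots> = (\<Sum>m\<in>Poly_Mapping.keys p. laur_eval s
      (Poly_Mapping.single m (Poly_Mapping.lookup p m)))
      * (\<Sum>m\<in>Poly_Mapping.keys r. laur_eval s (Poly_Mapping.single m (Poly_Mapping.lookup r m)))"
    by (simp add: sum_product laur_eval_sum laur_eval_single_mult)
  also have "\<dots> = laur_eval s p * laur_eval s r"
    by (simp flip: sum_single_lookup laur_eval_sum)
  finally show ?thesis .
qed

lemma laur_eval_Const: "laur_eval s (Const c) = scal c"
  by (simp add: Const_def laur_eval_single)

lemma laur_eval_1: "laur_eval s 1 = 1"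
  using laur_eval_Const[of s 1] by (simp add: Const_simps scal_simps)

lemma laur_eval_Var: "laur_eval s (Var v) = s v"
proof -
  have "(\<Prod>u\<in>UNIV. s u ^ Poly_Mapping.lookup (Poly_Mapping.single v (1::nat)) u)
      = (\<Prod>u\<in>UNIV. if u = v then s u else 1)"
    by (intro prod.cong) (auto simp: lookup_single when_def)
  then show ?thesis by (simp add: Var_def laur_eval_single scal_simps)
qed

lemma laur_eval_power: "laur_eval s (p ^ n) = laur_eval s p ^ n"
  by (induction n) (simp_all add: laur_eval_1 laur_eval_mult)

lemma prod_mon_unit: "(\<Prod>u\<in>UNIV. mon (unit_expo u) ^ Poly_Mapping.lookup m u)
    = mon (\<lambda>u. int (Poly_Mapping.lookup m u))"
proof -
  have "(\<Prod>u\<in>UNIV. mon (unit_expo u) ^ Poly_Mapping.lookup m u)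
      = mon (\<Sum>u\<in>UNIV. (\<lambda>w. int (Poly_Mapping.lookup m u) * unit_expo u w))"
    unfolding mon_power UNIV_coord by (simp add: mon_add[symmetric] add_ac)
  also have "(\<Sum>u\<in>UNIV. (\<lambda>w. int (Poly_Mapping.lookup m u) * unit_expo u w))
      = (\<lambda>u. int (Poly_Mapping.lookup m u))"
  proof
    fix w show "(\<Sum>u\<in>UNIV. (\<lambda>w. int (Poly_Mapping.lookup m u) * unit_expo u w)) w
        = int (Poly_Mapping.lookup m w)"
      by (cases w) (simp_all add: UNIV_coord unit_expo_def)
  qed
  finally show ?thesis .
qed

section \<open>Coefficients of a polynomial\<close>

text \<open>
  Coefficients are indexed by integer exponents and vanish at negative ones, so that the shifts
  of exponents caused by a substitution need no side conditions.
\<close>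

definition pol_coeff :: "pol \<Rightarrow> expo \<Rightarrow> ratt" where
  "pol_coeff p \<mu> = (if \<forall>v. 0 \<le> \<mu> v then Poly_Mapping.lookup p
      (Abs_poly_mapping (\<lambda>v. nat (\<mu> v))) else 0)"

lemma exponent_le_tdegree:
  assumes "m \<in> Poly_Mapping.keys p"
  shows "(\<Sum>v\<in>UNIV. Poly_Mapping.lookup m v) \<le> tdegree p"
  unfolding tdegree_def using assms by (intro Max_ge finite.insertI finite_imageI insertI2 imageI)
      simp_all

lemma pol_coeff_degree:
  assumes "\<not> (\<forall>v. 0 \<le> \<mu> v) \<or> (\<Sum>v\<in>UNIV. \<mu> v) > int (tdegree p)"
  shows "pol_coeff p \<mu> = 0"
proof (rule ccontr)
  assume nz: "pol_coeff p \<mu> \<noteq> 0"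
  let ?m = "Abs_poly_mapping (\<lambda>v. nat (\<mu> v))"
  have pos: "\<And>v. 0 \<le> \<mu> v" and m: "?m \<in> Poly_Mapping.keys p"
    using nz by (auto simp: pol_coeff_def in_keys_iff split: if_splits)
  have "(\<Sum>v\<in>UNIV. Poly_Mapping.lookup ?m v) \<le> tdegree p"
    using m by (rule exponent_le_tdegree)
  then have "(\<Sum>v\<in>UNIV. nat (\<mu> v)) \<le> tdegree p"
    by simp
  then have "int (\<Sum>v\<in>UNIV. nat (\<mu> v)) \<le> int (tdegree p)"
    by (rule of_nat_mono)
  moreover have "(\<Sum>v\<in>UNIV. \<mu> v) = int (\<Sum>v\<in>UNIV. nat (\<mu> v))"
    unfolding of_nat_sum using pos by (intro sum.cong) auto
  ultimately have "(\<Sum>v\<in>UNIV. \<mu> v) \<le> int (tdegree p)"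
    by linarith
  then show False using assms pos by auto
qed

lemma pol_eqI:
  assumes "\<And>\<mu>. pol_coeff p \<mu> = pol_coeff r \<mu>"
  shows "p = r"
proof (rule poly_mapping_eqI)
  fix m
  have "Abs_poly_mapping (\<lambda>v. nat (int (Poly_Mapping.lookup m v))) = (m :: coord \<Rightarrow>\<^sub>0 nat)"
    by (rule poly_mapping_eqI) simp
  then show "Poly_Mapping.lookup p m = Poly_Mapping.lookup r m"
    using assms[of "\<lambda>v. int (Poly_Mapping.lookup m v)"] by (simp add: pol_coeff_def)
qed

text \<open>
  This extracts one coefficient of a Laurent polynomial that arises from \<open>p\<close> by reweighting its
  coefficients with \<open>c\<close> and translating its exponents.
\<close>

lemma pol_coeff_as_sum:
  "(\<Sum>m\<in>Poly_Mapping.keys p. (Poly_Mapping.lookup p m * c m) *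
      (1 when (\<lambda>u. int (Poly_Mapping.lookup m u)) = \<nu>))
   = pol_coeff p \<nu> * c (Abs_poly_mapping (\<lambda>v. nat (\<nu> v)))"
proof (cases "\<forall>v. 0 \<le> \<nu> v")
  case True
  let ?m = "Abs_poly_mapping (\<lambda>v. nat (\<nu> v)) :: coord \<Rightarrow>\<^sub>0 nat"
  have *: "(\<lambda>u. int (Poly_Mapping.lookup m u)) = \<nu> \<longleftrightarrow> m = ?m" for m
  proof
    assume "(\<lambda>u. int (Poly_Mapping.lookup m u)) = \<nu>"
    then have "(\<lambda>v. nat (\<nu> v)) = Poly_Mapping.lookup m" by auto
    then show "m = ?m" by simp
  qed (use True in auto)
  have "(\<Sum>m\<in>Poly_Mapping.keys p. (Poly_Mapping.lookup p m * c m) * (1 when m = ?m))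
      = (\<Sum>m\<in>Poly_Mapping.keys p. if m = ?m then Poly_Mapping.lookup p m * c m else 0)"
    by (intro sum.cong) (auto simp: when_def)
  then show ?thesis using True
    unfolding * by (simp add: sum.delta pol_coeff_def in_keys_iff)
next
  case False
  then have "(\<lambda>u. int (Poly_Mapping.lookup m u)) \<noteq> \<nu>" for m :: "coord \<Rightarrow>\<^sub>0 nat" by auto
  with False show ?thesis by (auto simp: pol_coeff_def)
qed

section \<open>Polynomiality in a chart as regularity along a divisor\<close>

text \<open>
  The value of \<open>\<delta>\<close> at a coordinate it moves is \<open>1\<close>, encoded by \<open>None\<close>, or a coordinate \<open>u\<close>,
  encoded by \<open>Some u\<close>. The three functions give it as a polynomial, as the exponent of a Laurent
  monomial, and through its time derivative.
\<close>

fun slope_pol :: "coord option \<Rightarrow> pol" where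
  "slope_pol None = 1"
| "slope_pol (Some u) = Var u"

fun slope_expo :: "coord option \<Rightarrow> expo" where
  "slope_expo None = 0"
| "slope_expo (Some u) = unit_expo u"

fun slope_rhs :: "(coord \<Rightarrow> pol) \<Rightarrow> coord option \<Rightarrow> pol" where
  "slope_rhs f None = 0"
| "slope_rhs f (Some u) = f u"

text \<open>
  The chart with pole \<open>k = b/e + g/e\<^sup>2\<close> along \<open>e = 0\<close> that moves \<open>v1\<close> and \<open>v2\<close>. The assumption
  \<open>fixed\<close> makes \<open>\<delta>\<close> square to zero on coordinates, which is why the change of coordinates is
  undone by flipping the sign of \<open>k\<close>.
\<close>

locale chart =
  fixes e v1 v2 :: coord and t1 t2 :: "coord option" and b g :: complex
  assumes distinct: "v1 \<noteq> v2" "e \<noteq> v1" "e \<noteq> v2"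
    and fixed: "Some v1 \<notin> {t1, t2}" "Some v2 \<notin> {t1, t2}"
begin

definition pole :: laur where
  "pole = scal (const_t b) * mon (- unit_expo e) + scal (const_t g) * mon (- unit_expo e) ^ 2"

text \<open>
  This is \<open>dk/de\<close>.
\<close>

definition pole_deriv :: laur where
  "pole_deriv = - (scal (const_t b) * mon (- unit_expo e) ^ 2)
      - scal (const_t (2 * g)) * mon (- unit_expo e) ^ 3"

definition pole_rat :: ratfun where
  "pole_rat = rc b / rv e + rc g / rv e ^ 2"

definition slope :: "coord \<Rightarrow> pol" where
  "slope v = (if v = v1 then slope_pol t1 else if v = v2 then slope_pol t2 else 0)"

definition slope_laur :: "coord \<Rightarrow> laur" where
  "slope_laur v = (if v = v1 then mon (slope_expo t1) else if v
      = v2 then mon (slope_expo t2) else 0)"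

definition slope_deriv :: "(coord \<Rightarrow> pol) \<Rightarrow> coord \<Rightarrow> pol" where
  "slope_deriv f v = (if v = v1 then slope_rhs f t1 else if v = v2 then slope_rhs f t2 else 0)"

definition new_coord :: "coord \<Rightarrow> ratfun" where
  "new_coord v = rv v - pole_rat * to_ratfun (slope v)"

text \<open>
  The old coordinates, written as Laurent polynomials in the new ones.
\<close>

definition old_coord :: "coord \<Rightarrow> laur" where
  "old_coord v = mon (unit_expo v) + pole * slope_laur v"

text \<open>
  \<open>expands_to r l\<close> says that \<open>l\<close> is the rational function \<open>r\<close> of the old coordinates rewritten
  in the new ones, provided that \<open>r\<close> has only powers of \<open>e\<close> as denominator. Phrasing the
  rewriting as a relation with cleared denominators avoids extending the substitution to the
  whole field of fractions; that the relation is functional rests on \<open>e\<close> being mapped to a unit.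
\<close>

definition expands_to :: "ratfun \<Rightarrow> laur \<Rightarrow> bool" where
  "expands_to r l \<longleftrightarrow> (\<exists>n P. r * rv e ^ n = to_ratfun P \<and> laur_eval old_coord P
      = mon (unit_expo e) ^ n * l)"

lemma old_coord_e: "old_coord e = mon (unit_expo e)"
  using distinct by (simp add: old_coord_def slope_laur_def)

lemma rv_e_nz: "rv e \<noteq> 0"
proof -
  have "Var e \<noteq> 0" by (metis Var_def lookup_single_eq lookup_zero one_neq_zero)
  then show ?thesis using to_ratfun_eq_iff[of "Var e" 0] by (simp add: to_ratfun_simps)
qed

lemma mon_e_inverse: "mon (unit_expo e) * mon (- unit_expo e) = 1"
  by (simp add: mon_0 flip: mon_add)

lemma mon_e_inverse_power: "mon (unit_expo e) ^ n * mon (- unit_expo e) ^ n = 1"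
  by (simp add: mon_e_inverse flip: power_mult_distrib)

lemma expands_to_unique:
  assumes "expands_to r l" "expands_to r l'"
  shows "l = l'"
proof -
  from assms obtain n P m Q where
    1: "r * rv e ^ n = to_ratfun P" "laur_eval old_coord P = mon (unit_expo e) ^ n * l" and
    2: "r * rv e ^ m = to_ratfun Q" "laur_eval old_coord Q = mon (unit_expo e) ^ m * l'"
    unfolding expands_to_def by blast
  have "to_ratfun (P * Var e ^ m) = to_ratfun (Q * Var e ^ n)"
    by (simp add: to_ratfun_simps to_ratfun_power flip: 1(1) 2(1))
  then have "laur_eval old_coord (P * Var e ^ m) = laur_eval old_coord (Q * Var e ^ n)"
    by (simp add: to_ratfun_eq_iff)
  then have "mon (unit_expo e) ^ (n + m) * l = mon (unit_expo e) ^ (n + m) * l'"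
    by (simp add: laur_eval_mult laur_eval_power laur_eval_Var old_coord_e 1(2) 2(2) power_add
        mult_ac)
  then have "mon (- unit_expo e) ^ (n + m) * (mon (unit_expo e) ^ (n + m) * l)
      = mon (- unit_expo e) ^ (n + m) * (mon (unit_expo e) ^ (n + m) * l')" by simp
  then show ?thesis
    by (simp add: mult.assoc[symmetric] mon_e_inverse_power mult.commute[of
        "mon (- unit_expo e) ^ _"])
qed

lemma expands_to_pol: "expands_to (to_ratfun P) (laur_eval old_coord P)"
  unfolding expands_to_def by (intro exI[of _ 0] exI[of _ P]) simp

lemma expands_to_mult: "expands_to r l \<Longrightarrow> expands_to r' l' \<Longrightarrow> expands_to (r * r') (l * l')"
  unfolding expands_to_def
proof (elim exE conjE)
  fix n P m Q
  assume 1: "r * rv e ^ n = to_ratfun P" "laur_eval old_coord P = mon (unit_expo e) ^ n * l" and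
    2: "r' * rv e ^ m = to_ratfun Q" "laur_eval old_coord Q = mon (unit_expo e) ^ m * l'"
  show "\<exists>n P. r * r' * rv e ^ n = to_ratfun P \<and> laur_eval old_coord P
      = mon (unit_expo e) ^ n * (l * l')"
    by (intro exI[of _ "n + m"] exI[of _ "P * Q"])
       (simp add: to_ratfun_simps laur_eval_mult 1(2) 2(2) power_add mult_ac flip: 1(1) 2(1))
qed

lemma expands_to_add: "expands_to r l \<Longrightarrow> expands_to r' l' \<Longrightarrow> expands_to (r + r') (l + l')"
  unfolding expands_to_def
proof (elim exE conjE)
  fix n P m Q
  assume 1: "r * rv e ^ n = to_ratfun P" "laur_eval old_coord P = mon (unit_expo e) ^ n * l" and
    2: "r' * rv e ^ m = to_ratfun Q" "laur_eval old_coord Q = mon (unit_expo e) ^ m * l'"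
  show "\<exists>n P. (r + r') * rv e ^ n = to_ratfun P \<and> laur_eval old_coord P
      = mon (unit_expo e) ^ n * (l + l')"
    by (intro exI[of _ "n + m"] exI[of _ "P * Var e ^ m + Q * Var e ^ n"])
       (simp add: to_ratfun_simps to_ratfun_power laur_eval_mult laur_eval_add laur_eval_power
           laur_eval_Var old_coord_e
          1(2) 2(2) power_add algebra_simps flip: 1(1) 2(1))
qed

lemma expands_to_Const: "expands_to (to_ratfun (Const c)) (scal c)"
  using expands_to_pol[of "Const c"] by (simp add: laur_eval_Const)

lemma expands_to_uminus: "expands_to r l \<Longrightarrow> expands_to (- r) (- l)"
  using expands_to_mult[of r l "to_ratfun (Const (-1))" "scal (-1)"] expands_to_Const[of "-1"]
  by (simp add: Const_simps scal_simps to_ratfun_simps)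

lemma expands_to_diff: "expands_to r l \<Longrightarrow> expands_to r' l' \<Longrightarrow> expands_to (r - r') (l - l')"
  using expands_to_add[of r l "- r'" "- l'"] expands_to_uminus[of r' l'] by simp

lemma expands_to_inverse: "expands_to (1 / rv e) (mon (- unit_expo e))"
  unfolding expands_to_def using rv_e_nz
  by (intro exI[of _ 1] exI[of _ 1]) (simp add: to_ratfun_simps laur_eval_1 mon_e_inverse)

lemma expands_to_power: "expands_to r l \<Longrightarrow> expands_to (r ^ n) (l ^ n)"
  by (induction n) (use expands_to_Const[of 1] in \<open>simp_all add: expands_to_mult Const_simps
      scal_simps to_ratfun_simps\<close>)

lemma expands_to_sum: "(\<And>i. i \<in> I \<Longrightarrow> expands_to (r i) (l i)) \<Longrightarrow> expands_to (\<Sum>i\<in>I. r i) (\<Sum>i\<in>I. l i)"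
  by (induction I rule: infinite_finite_induct)
     (use expands_to_Const[of 0] in \<open>simp_all add: expands_to_add Const_simps scal_simps
         to_ratfun_simps\<close>)

lemma expands_to_prod: "(\<And>i. i \<in> I \<Longrightarrow> expands_to (r i) (l i)) \<Longrightarrow> expands_to (\<Prod>i\<in>I. r i) (\<Prod>i\<in>I. l i)"
  by (induction I rule: infinite_finite_induct)
     (use expands_to_Const[of 1] in \<open>simp_all add: expands_to_mult Const_simps scal_simps
         to_ratfun_simps\<close>)

lemma expands_to_pole: "expands_to pole_rat pole"
proof -
  have "expands_to (rc b * (1 / rv e) + rc g * (1 / rv e) ^ 2) pole"
    unfolding pole_def by (intro expands_to_add expands_to_mult expands_to_power expands_to_inverse
        expands_to_Const)
  then show ?thesis by (simp add: pole_rat_def power_divide)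
qed

lemma laur_eval_slope_pol: "laur_eval old_coord (slope_pol t) = mon (slope_expo t)" if
    "t \<in> {t1, t2}"
  using that fixed by (cases t) (auto simp: laur_eval_1 mon_0 laur_eval_Var old_coord_def
      slope_laur_def)

lemma expands_to_slope: "expands_to (to_ratfun (slope v)) (slope_laur v)"
  using expands_to_pol[of "slope v"] distinct
      by (auto simp: slope_def slope_laur_def laur_eval_slope_pol laur_eval_0)

lemma expands_to_new_coord: "expands_to (new_coord v) (mon (unit_expo v))"
proof -
  have "expands_to (new_coord v) (old_coord v - pole * slope_laur v)"
    unfolding new_coord_def using expands_to_pol[of "Var v"]
    by (intro expands_to_diff expands_to_mult expands_to_pole expands_to_slope) (simp
        add: laur_eval_Var)
  then show ?thesis by (simp add: old_coord_def)
qed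

text \<open>
  A polynomial expression in the new coordinates expands to a polynomial, because each new
  coordinate expands to the corresponding variable.
\<close>

lemma expands_to_subst: "expands_to (subst new_coord h) (laur_eval (\<lambda>v. mon (unit_expo v)) h)"
  unfolding subst_def laur_eval_def
  by (intro expands_to_sum expands_to_mult expands_to_prod expands_to_Const expands_to_power
      expands_to_new_coord)

lemma laur_eval_unit_nonneg:
  assumes "\<mu> v < 0"
  shows "Poly_Mapping.lookup (laur_eval (\<lambda>v. mon (unit_expo v)) h) \<mu> = 0"
proof -
  have "Poly_Mapping.lookup (scal c * mon (\<lambda>u. int (Poly_Mapping.lookup m u))) \<mu> = 0" for c and m ::
      "coord \<Rightarrow>\<^sub>0 nat"
  proof -
    have "\<mu> v \<noteq> int (Poly_Mapping.lookup m v)" using assms by linarith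
    then have "\<mu> \<noteq> (\<lambda>u. int (Poly_Mapping.lookup m u))" by metis
    then show ?thesis using lookup_scal_mon_mult[of c _ 1 \<mu>] by (simp add: lookup_one)
  qed
  then show ?thesis by (simp add: laur_eval_def prod_mon_unit lookup_sum)
qed

text \<open>
  The product rule for \<open>v - k \<cdot> \<delta> v\<close>, together with \<open>dk/dt = k' \<cdot> f\<^sub>e\<close>, where \<open>b\<close> and \<open>g\<close> are
  constants.
\<close>

lemma D_new_coord:
  assumes "d_dt_along f D"
  shows "expands_to (D (new_coord v)) (laur_eval old_coord (f v)
      - pole * laur_eval old_coord (slope_deriv f v)
      - pole_deriv * slope_laur v * laur_eval old_coord (f e))"
proof -
  from assms have D_add: "\<And>a b. D (a + b) = D a + D b"
    and D_mult: "\<And>a b. D (a * b) = D a * b + a * D b"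
    and D_rc: "\<And>c. D (rc c) = 0" and D_rv: "\<And>v. D (rv v) = to_ratfun (f v)"
    unfolding d_dt_along_def by blast+
  have D_0: "D 0 = 0" and D_1: "D 1 = 0"
    using D_rc[of 0] D_rc[of 1] by (simp_all add: const_t_simps Const_simps to_ratfun_simps)
  have D_uminus: "D (- a) = - D a" for a
    using D_add[of a "- a"] by (simp add: D_0 eq_neg_iff_add_eq_0 add.commute)
  have D_diff: "D (a - b) = D a - D b" for a b
    using D_add[of a "- b"] by (simp add: D_uminus)
  have D_inv: "D (1 / rv e) = - (to_ratfun (f e) * (1 / rv e) ^ 2)"
  proof -
    have "to_ratfun (f e) * (1 / rv e) + rv e * D (1 / rv e) = D (rv e * (1 / rv e))"
      by (simp only: D_mult D_rv)
    also have "\<dots> = 0" using rv_e_nz by (simp add: D_1)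
    finally have "rv e * D (1 / rv e) = - (to_ratfun (f e) * (1 / rv e))"
      by (simp only: eq_neg_iff_add_eq_0 add.commute)
    then have "1 / rv e * (rv e * D (1 / rv e)) = 1 / rv e * (- (to_ratfun (f e) * (1 / rv e)))"
      by (simp only:)
    moreover have "1 / rv e * (rv e * D (1 / rv e)) = D (1 / rv e)"
      using rv_e_nz by simp
    ultimately show ?thesis by (simp only: power2_eq_square mult_minus_right mult_ac)
  qed
  define i where "i = 1 / rv e"
  have rc_2g: "rc (2 * g) = rc g + rc g"
    unfolding mult_2 const_t_simps Const_simps to_ratfun_simps ..
  have pole_rat: "pole_rat = rc b * i + rc g * (i * i)"
    by (simp add: pole_rat_def i_def power2_eq_square)
  have D_pole: "D pole_rat = - (rc b * i ^ 2 * to_ratfun (f e))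
      - rc (2 * g) * i ^ 3 * to_ratfun (f e)"
    unfolding pole_rat D_add D_mult D_rc D_inv[folded i_def] rc_2g by algebra
  have D_slope: "D (to_ratfun (slope v)) = to_ratfun (slope_deriv f v)"
  proof -
    have "D (to_ratfun (slope_pol t)) = to_ratfun (slope_rhs f t)" for t
      by (cases t) (simp_all add: to_ratfun_simps D_0 D_1 D_rv)
    then show ?thesis by (simp add: slope_def slope_deriv_def to_ratfun_simps D_0)
  qed
  have "D (new_coord v) = to_ratfun (f v) - pole_rat * to_ratfun (slope_deriv f v)
     - (- (rc b * i ^ 2) - rc (2 * g) * i ^ 3) * to_ratfun (slope v) * to_ratfun (f e)"
    unfolding new_coord_def D_diff D_mult D_pole D_slope D_rv by algebra
  moreover have "expands_to \<dots> (laur_eval old_coord (f v)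
      - pole * laur_eval old_coord (slope_deriv f v)
      - pole_deriv * slope_laur v * laur_eval old_coord (f e))"
    unfolding pole_deriv_def i_def
    by (intro expands_to_diff expands_to_mult expands_to_uminus expands_to_pole expands_to_pol
        expands_to_slope expands_to_power expands_to_inverse expands_to_Const)
  ultimately show ?thesis by simp
qed

text \<open>
  The derivative of a new coordinate has two expansions: the one given by the product rule and,
  by hypothesis, one without negative exponents. They agree because expansions are unique.
\<close>

theorem regular:
  assumes "d_dt_along f D" "polynomial_in_coords D new_coord" "\<mu> e < 0"
  shows "Poly_Mapping.lookup
    (laur_eval old_coord (f v) - pole * laur_eval old_coord (slope_deriv f v)
        - pole_deriv * slope_laur v * laur_eval old_coord (f e)) \<mu> = 0"
proof -
  from assms(2) obtain h where "D (new_coord v) = subst new_coord h"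
    unfolding polynomial_in_coords_def by blast
  then have "laur_eval old_coord (f v) - pole * laur_eval old_coord (slope_deriv f v)
      - pole_deriv * slope_laur v * laur_eval old_coord (f e)
      = laur_eval (\<lambda>v. mon (unit_expo v)) h"
    using D_new_coord[OF assms(1), of v] expands_to_subst[of h] by (metis expands_to_unique)
  then show ?thesis using laur_eval_unit_nonneg[of \<mu> e h] assms(3) by simp
qed

end

section \<open>Taylor expansion along the direction of a chart\<close>

text \<open>
  Multiplication by \<open>b/x + g/x\<^sup>2\<close>, acting on the coefficients of a Laurent series in \<open>x\<close>.
\<close>

definition pole_op :: "'a::semiring_1 \<Rightarrow> 'a \<Rightarrow> (int \<Rightarrow> 'a) \<Rightarrow> int \<Rightarrow> 'a" where
  "pole_op b g h i = b * h (i + 1) + g * h (i + 2)"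

lemma binomial_row_upto_3:
  fixes x :: "'a::comm_ring_1"
  assumes "j \<le> 3"
  shows "(1 + x) ^ j = (\<Sum>r\<le>3. of_nat (j choose r) * x ^ r)"
proof -
  have "(1 + x) ^ j = (\<Sum>r\<le>j. of_nat (j choose r) * x ^ r)"
    using binomial_ring[of x 1 j] by (simp add: add.commute)
  also have "\<dots> = (\<Sum>r\<le>3. of_nat (j choose r) * x ^ r)"
    using assms by (intro sum.mono_neutral_left ballI) (simp_all add: binomial_eq_0)
  finally show ?thesis .
qed

text \<open>
  The terms are grouped by total degree because \<open>x\<close> and \<open>y\<close> will both carry one factor \<open>k\<close>, and
  the pole order is controlled by the power of \<open>k\<close>.
\<close>

lemma binomial_product_upto_3:
  fixes x y :: "'a::comm_ring_1"
  assumes "j + l \<le> 3"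
  shows "(1 + x) ^ j * (1 + y) ^ l
    = (\<Sum>k\<le>3. \<Sum>r\<le>k. of_nat ((j choose r) * (l choose (k - r))) * (x ^ r * y ^ (k - r)))"
proof -
  have "(1 + x) ^ j * (1 + y) ^ l
      = (\<Sum>(r, s)\<in>{..3} \<times> {..3}. of_nat ((j choose r) * (l choose s)) * (x ^ r * y ^ s))"
    using assms by (simp add: binomial_row_upto_3 sum_product sum.cartesian_product mult_ac)
  also have "\<dots> = (\<Sum>(r, s)\<in>{(r, s). r + s \<le> 3}. of_nat ((j choose r) * (l choose s)) *
      (x ^ r * y ^ s))"
  proof (intro sum.mono_neutral_right ballI)
    fix rs :: "nat \<times> nat"
    assume "rs \<in> {..3} \<times> {..3} - {(r, s). r + s \<le> 3}"
    then have "j < fst rs \<or> l < snd rs" using assms by auto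
    then show "(case rs of (r, s) \<Rightarrow> of_nat ((j choose r) * (l choose s)) * (x ^ r * y ^ s)) = 0"
      by (auto simp: binomial_eq_0 split: prod.split)
  qed auto
  finally show ?thesis by (simp only: sum.triangle_reindex_eq)
qed

context chart
begin

text \<open>
  Replacing \<open>r\<close> factors \<open>v1\<close> by \<open>\<delta> v1\<close> and \<open>s\<close> factors \<open>v2\<close> by \<open>\<delta> v2\<close> lowers the exponent by
  \<open>shift r s\<close>.
\<close>

definition shift :: "nat \<Rightarrow> nat \<Rightarrow> expo" where
  "shift r s = (\<lambda>u. int r * (unit_expo v1 u - slope_expo t1 u)
      + int s * (unit_expo v2 u - slope_expo t2 u))"

text \<open>
  The \<open>(r, s)\<close> term of the Taylor expansion of \<open>p\<close> in \<open>v1\<close> and \<open>v2\<close>, evaluated at the increments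
  \<open>\<delta> v1\<close> and \<open>\<delta> v2\<close>; the binomial coefficients are those of the divided derivatives.
\<close>

definition taylor :: "pol \<Rightarrow> nat \<Rightarrow> nat \<Rightarrow> laur" where
  "taylor p r s = (\<Sum>m\<in>Poly_Mapping.keys p. scal (Poly_Mapping.lookup p m
      * of_nat ((Poly_Mapping.lookup m v1 choose r) * (Poly_Mapping.lookup m v2 choose s)))
      * mon ((\<lambda>u. int (Poly_Mapping.lookup m u)) - shift r s))"

text \<open>
  Pulling out the monomial reduces powers of old coordinates to powers of \<open>1 + k \<cdot> s\<close> with \<open>s\<close> a
  monomial.
\<close>

lemma old_coord_factored: "old_coord v = mon (unit_expo v) * (if v = v1 then 1
    + pole * mon (slope_expo t1 - unit_expo v1)
    else if v = v2 then 1 + pole * mon (slope_expo t2 - unit_expo v2) else 1)"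
proof -
  have "mon (unit_expo v) * (pole * mon (d - unit_expo v)) = pole * mon d" for v d
    by (subst mult.left_commute) (simp flip: mon_add)
  then show ?thesis
    by (simp add: old_coord_def slope_laur_def distrib_left)
qed

lemma laur_eval_old_coord_monomial:
  assumes "(\<Sum>v\<in>UNIV. Poly_Mapping.lookup m v) \<le> 3"
  shows "(\<Prod>v\<in>UNIV. old_coord v ^ Poly_Mapping.lookup m v) = (\<Sum>k\<le>3. \<Sum>r\<le>k. pole ^ k
    * (scal (of_nat ((Poly_Mapping.lookup m v1 choose r) * (Poly_Mapping.lookup m v2 choose (k
        - r))))
      * mon ((\<lambda>u. int (Poly_Mapping.lookup m u)) - shift r (k - r))))"
proof -
  let ?j = "Poly_Mapping.lookup m v1" and ?l = "Poly_Mapping.lookup m v2"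
  let ?M = "mon (\<lambda>u. int (Poly_Mapping.lookup m u))"
  let ?s1 = "mon (slope_expo t1 - unit_expo v1)" and ?s2 = "mon (slope_expo t2 - unit_expo v2)"
  have "?j + ?l = (\<Sum>v\<in>{v1, v2}. Poly_Mapping.lookup m v)"
    using distinct by simp
  also have "\<dots> \<le> (\<Sum>v\<in>UNIV. Poly_Mapping.lookup m v)"
    by (intro sum_mono2) auto
  finally have jl: "?j + ?l \<le> 3" using assms by simp
  have "(\<Prod>v\<in>UNIV. (if v = v1 then 1 + pole * ?s1 else if v = v2 then 1
      + pole * ?s2 else 1) ^ Poly_Mapping.lookup m v)
     = (\<Prod>v\<in>{v1, v2}. (if v = v1 then 1 + pole * ?s1 else if v = v2 then 1
         + pole * ?s2 else 1) ^ Poly_Mapping.lookup m v)"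
    by (intro prod.mono_neutral_right) auto
  also have "\<dots> = (1 + pole * ?s1) ^ ?j * (1 + pole * ?s2) ^ ?l"
    using distinct by simp
  finally have "(\<Prod>v\<in>UNIV. old_coord v ^ Poly_Mapping.lookup m v)
      = ?M * ((1 + pole * ?s1) ^ ?j * (1 + pole * ?s2) ^ ?l)"
    unfolding old_coord_factored power_mult_distrib prod.distrib prod_mon_unit by simp
  also have "\<dots> = (\<Sum>k\<le>3. \<Sum>r\<le>k. ?M * (of_nat ((?j choose r) * (?l choose (k
      - r))) * ((pole * ?s1) ^ r * (pole * ?s2) ^ (k - r))))"
    unfolding binomial_product_upto_3[OF jl] by (simp add: sum_distrib_left)
  also have "\<dots> = (\<Sum>k\<le>3. \<Sum>r\<le>k. pole ^ k
    * (scal (of_nat ((?j choose r) * (?l choose (k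
        - r)))) * mon ((\<lambda>u. int (Poly_Mapping.lookup m u)) - shift r (k - r))))"
  proof (intro sum.cong refl)
    fix k r :: nat
    assume "r \<in> {..k}"
    then have k: "pole ^ k = pole ^ r * pole ^ (k - r)" by (simp flip: power_add)
    have M: "mon ((\<lambda>u. int (Poly_Mapping.lookup m u)) - shift r (k - r))
        = ?M * (?s1 ^ r * ?s2 ^ (k - r))"
      unfolding mon_power by (simp add: shift_def algebra_simps fun_eq_iff flip: mon_add)
        (rule arg_cong[of _ _ mon], simp add: fun_eq_iff algebra_simps)
    have scal_of_nat: "scal (of_nat n) = of_nat n" for n
      by (induction n) (simp_all add: scal_simps)
    show "?M * (of_nat ((?j choose r) * (?l choose (k - r))) * ((pole * ?s1) ^ r * (pole * ?s2) ^ (k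
        - r)))
      = pole ^ k * (scal (of_nat ((?j choose r) * (?l choose (k
          - r)))) * mon ((\<lambda>u. int (Poly_Mapping.lookup m u)) - shift r (k - r)))"
      unfolding M scal_of_nat power_mult_distrib k by (simp only: mult_ac)
  qed
  finally show ?thesis .
qed

lemma laur_eval_old_coord_expansion:
  assumes "tdegree p \<le> 3"
  shows "laur_eval old_coord p = (\<Sum>k\<le>3. \<Sum>r\<le>k. pole ^ k * taylor p r (k - r))"
proof -
  have "laur_eval old_coord p = (\<Sum>m\<in>Poly_Mapping.keys p. \<Sum>k\<le>3. \<Sum>r\<le>k. pole ^ k
    * (scal (Poly_Mapping.lookup p m
      * of_nat ((Poly_Mapping.lookup m v1 choose r) * (Poly_Mapping.lookup m v2 choose (k - r))))
      * mon ((\<lambda>u. int (Poly_Mapping.lookup m u)) - shift r (k - r))))"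
    unfolding laur_eval_def
  proof (intro sum.cong refl)
    fix m assume "m \<in> Poly_Mapping.keys p"
    then have "(\<Sum>v\<in>UNIV. Poly_Mapping.lookup m v) \<le> 3"
      using exponent_le_tdegree assms le_trans by blast
    from laur_eval_old_coord_monomial[OF this]
    show "scal (Poly_Mapping.lookup p m) * (\<Prod>v\<in>UNIV. old_coord v ^ Poly_Mapping.lookup m v)
      = (\<Sum>k\<le>3. \<Sum>r\<le>k. pole ^ k * (scal (Poly_Mapping.lookup p m
        * of_nat ((Poly_Mapping.lookup m v1 choose r) * (Poly_Mapping.lookup m v2 choose (k - r))))
        * mon ((\<lambda>u. int (Poly_Mapping.lookup m u)) - shift r (k - r))))"
      by (simp add: scal_simps sum_distrib_left mult_ac)
  qed
  also have "\<dots> = (\<Sum>k\<le>3. \<Sum>r\<le>k. pole ^ k * taylor p r (k - r))"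
    unfolding taylor_def sum_distrib_left
    by (subst sum.swap, intro sum.cong refl, subst sum.swap, intro sum.cong refl)
  finally show ?thesis .
qed

lemma lookup_taylor:
  "Poly_Mapping.lookup (taylor p r s) \<mu>
    = of_nat ((nat (\<mu> v1 + int r) choose r) * (nat (\<mu> v2 + int s) choose s)) * pol_coeff p (\<mu>
        + shift r s)"
proof -
  have "Poly_Mapping.lookup (scal c * mon (\<nu> - shift r s)) \<mu> = c * (1 when \<nu> = \<mu> + shift r s)" for c
      \<nu>
    using lookup_scal_mon_mult[of c "\<nu> - shift r s" 1 \<mu>]
    by (simp add: lookup_one when_def algebra_simps)
  then have "Poly_Mapping.lookup (taylor p r s) \<mu>
      = (\<Sum>m\<in>Poly_Mapping.keys p. (Poly_Mapping.lookup p m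
          * of_nat ((Poly_Mapping.lookup m v1 choose r) * (Poly_Mapping.lookup m v2 choose s)))
          * (1 when (\<lambda>u. int (Poly_Mapping.lookup m u)) = \<mu> + shift r s))"
    by (simp add: taylor_def lookup_sum)
  also have "\<dots> = pol_coeff p (\<mu> + shift r s) * of_nat ((nat ((\<mu>
      + shift r s) v1) choose r) * (nat ((\<mu> + shift r s) v2) choose s))"
    by (subst pol_coeff_as_sum) simp
  also have "(\<mu> + shift r s) v1 = \<mu> v1 + int r"
    unfolding shift_def using distinct fixed by (cases t1; cases t2) (auto simp: unit_expo_def)
  also have "(\<mu> + shift r s) v2 = \<mu> v2 + int s"
    unfolding shift_def using distinct fixed by (cases t1; cases t2) (auto simp: unit_expo_def)
  finally show ?thesis by (simp only: mult.commute)
qed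

lemma lookup_pole_mult:
  "Poly_Mapping.lookup (pole * l) (\<mu>(e := i))
    = pole_op (const_t b) (const_t g) (\<lambda>i. Poly_Mapping.lookup l (\<mu>(e := i))) i"
proof -
  have 1: "\<mu>(e := i) - (- unit_expo e) = \<mu>(e := i + 1)" and 2:
      "\<mu>(e := i) - (- unit_expo e - unit_expo e) = \<mu>(e := i + 2)"
    by (auto simp: unit_expo_def fun_eq_iff)
  have "pole * l = scal (const_t b) * mon (- unit_expo e) * l
      + scal (const_t g) * mon (- unit_expo e - unit_expo e) * l"
    by (simp add: pole_def power2_eq_square distrib_right flip: mon_add)
  then show ?thesis
    by (simp only: lookup_add lookup_scal_mon_mult pole_op_def 1 2)
qed

lemma lookup_pole_power_mult:
  "Poly_Mapping.lookup (pole ^ n * l) (\<mu>(e := i))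
    = (pole_op (const_t b) (const_t g) ^^ n) (\<lambda>i. Poly_Mapping.lookup l (\<mu>(e := i))) i"
proof (induction n arbitrary: i)
  case (Suc n)
  have "Poly_Mapping.lookup (pole ^ Suc n * l) (\<mu>(e := i))
      = Poly_Mapping.lookup (pole * (pole ^ n * l)) (\<mu>(e := i))"
    by (simp add: mult_ac)
  then show ?case
    by (simp only: lookup_pole_mult Suc funpow.simps o_apply)
qed simp

text \<open>
  A coefficient of a cubic rewritten in the new coordinates, as a combination of the
  coefficients of the cubic. Only the exponent \<open>i\<close> of \<open>e\<close> is affected by the powers of \<open>k\<close>.
\<close>

theorem lookup_laur_eval_old_coord:
  assumes "tdegree p \<le> 3"
  shows "Poly_Mapping.lookup (laur_eval old_coord p) (\<mu>(e := i)) = (\<Sum>k\<le>3.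
    (pole_op (const_t b) (const_t g) ^^ k) (\<lambda>i. \<Sum>r\<le>k.
      of_nat ((nat (\<mu> v1 + int r) choose r) * (nat (\<mu> v2 + int (k - r)) choose (k - r)))
      * pol_coeff p (\<mu>(e := i) + shift r (k - r))) i)"
  using distinct
  by (simp add: laur_eval_old_coord_expansion[OF assms] lookup_sum lookup_pole_power_mult
      lookup_taylor flip: sum_distrib_left)

lemma lookup_pole_deriv_mult:
  "Poly_Mapping.lookup (pole_deriv * mon \<delta> * l) (\<mu>(e := i))
    = - (const_t b * Poly_Mapping.lookup l (\<mu>(e := i + 2) - \<delta>))
      - 2 * const_t g * Poly_Mapping.lookup l (\<mu>(e := i + 3) - \<delta>)"
proof -
  have "\<mu>(e := i) - (- unit_expo e - unit_expo e) = \<mu>(e := i + 2)"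
      "\<mu>(e := i) - (- unit_expo e - unit_expo e - unit_expo e) = \<mu>(e := i + 3)"
    by (auto simp: unit_expo_def fun_eq_iff)
  then have 1: "\<mu>(e := i) - (\<delta> - unit_expo e - unit_expo e) = \<mu>(e := i + 2) - \<delta>"
    and 2: "\<mu>(e := i) - (\<delta> - unit_expo e - unit_expo e - unit_expo e) = \<mu>(e := i + 3) - \<delta>"
    by (simp_all add: algebra_simps)
  have 3: "mon (\<delta> - unit_expo e - unit_expo e) = mon \<delta> * mon (- unit_expo e) ^ 2"
    and 4: "mon (\<delta> - unit_expo e - unit_expo e - unit_expo e) = mon \<delta> * mon (- unit_expo e) ^ 3"
    by (simp_all add: power2_eq_square power3_eq_cube algebra_simps flip: mon_add)
  have "pole_deriv * mon \<delta> * l = - (scal (const_t b) * mon (\<delta> - unit_expo e - unit_expo e) * l)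
    - scal (2 * const_t g) * mon (\<delta> - unit_expo e - unit_expo e - unit_expo e) * l"
    unfolding pole_deriv_def const_t_simps const_t_numeral 3 4 by (simp add: algebra_simps)
  then show ?thesis by (simp only: lookup_minus lookup_uminus lookup_scal_mon_mult 1 2)
qed

end

section \<open>Cubics that stay polynomial in a chart\<close>

type_synonym 'a coeff_fun = "int \<Rightarrow> int \<Rightarrow> int \<Rightarrow> int \<Rightarrow> int \<Rightarrow> 'a"

text \<open>
  From here on a polynomial is given by its coefficients: \<open>a i j l m n\<close> belongs to
  \<open>x\<^sup>i y\<^sup>j z\<^sup>l w\<^sup>m q\<^sup>n\<close>, and is zero if an exponent is negative. On coefficients,
  \<open>divided_power_yw k\<close> is the differential operator \<open>(q \<partial>\<^sub>y + \<partial>\<^sub>w)\<^sup>k / k!\<close>.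
\<close>

definition divided_power_yw :: "nat \<Rightarrow> 'a::semiring_1 coeff_fun \<Rightarrow> 'a coeff_fun" where
  "divided_power_yw k a i j l m n = (\<Sum>r\<le>k.
     of_nat ((nat (j + int r) choose r) * (nat (m + int (k - r)) choose (k - r)))
     * a i (j + int r) l (m + int (k - r)) (n - int r))"

text \<open>
  The substitution \<open>y \<mapsto> y + k q\<close>, \<open>w \<mapsto> w + k\<close> with \<open>k = b/x + g/x\<^sup>2\<close>, which is the exponential
  of \<open>k \<cdot> (q \<partial>\<^sub>y + \<partial>\<^sub>w)\<close>, on polynomials of degree at most 3.
\<close>

definition subst_yw :: "'a::semiring_1 \<Rightarrow> 'a \<Rightarrow> 'a coeff_fun \<Rightarrow> 'a coeff_fun" where
  "subst_yw b g a i j l m n = (\<Sum>k\<le>3. (pole_op b g ^^ k) (\<lambda>i. divided_power_yw k a i j l m n) i)"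

text \<open>
  The differential operator \<open>(q \<partial>\<^sub>x + w \<partial>\<^sub>z)\<^sup>k / k!\<close>.
\<close>

definition divided_power_xz :: "nat \<Rightarrow> 'a::semiring_1 coeff_fun \<Rightarrow> 'a coeff_fun" where
  "divided_power_xz k a i j l m n = (\<Sum>r\<le>k.
     of_nat ((nat (i + int r) choose r) * (nat (l + int (k - r)) choose (k - r)))
     * a (i + int r) j (l + int (k - r)) (m - int (k - r)) (n - int r))"

text \<open>
  The substitution \<open>x \<mapsto> x + k q\<close>, \<open>z \<mapsto> z + k w\<close> with \<open>k = b/y\<close>.
\<close>

definition subst_xz :: "'a::semiring_1 \<Rightarrow> 'a coeff_fun \<Rightarrow> 'a coeff_fun" where
  "subst_xz b a i j l m n = (\<Sum>k\<le>3. (pole_op b 0 ^^ k) (\<lambda>j. divided_power_xz k a i j l m n) j)"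

definition cubic :: "'a::zero coeff_fun \<Rightarrow> bool" where
  "cubic a \<longleftrightarrow> (\<forall>i j l m n. a i j l m n \<noteq> 0 \<longrightarrow>
     0 \<le> i \<and> 0 \<le> j \<and> 0 \<le> l \<and> 0 \<le> m \<and> 0 \<le> n \<and> i + j + l + m + n \<le> 3)"

lemma cubicD:
  assumes "cubic a" "i < 0 \<or> j < 0 \<or> l < 0 \<or> m < 0 \<or> n < 0 \<or> 3 < i + j + l + m + n"
  shows "a i j l m n = 0"
  using assms unfolding cubic_def by (meson not_less)

lemma pole_op_power_sum:
  fixes h :: "nat \<Rightarrow> int \<Rightarrow> 'a::comm_ring_1"
  shows "(\<Sum>k\<le>3. (pole_op b g ^^ k) (h k) i) = h 0 i + (b * h 1 (i + 1) + g * h 1 (i + 2))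
    + (b^2 * h 2 (i + 2) + 2 * b * g * h 2 (i + 3) + g^2 * h 2 (i + 4))
    + (b^3 * h 3 (i + 3) + 3 * b^2 * g * h 3 (i + 4) + 3 * b * g^2 * h 3 (i + 5)
        + g^3 * h 3 (i + 6))"
  by (simp add: pole_op_def numeral_eq_Suc algebra_simps)

lemma sum_upto_numeral:
  "(\<Sum>r\<le>Suc 0. h r) = h 0 + h 1" "(\<Sum>r\<le>2. h r) = h 0 + h 1 + h 2"
      "(\<Sum>r\<le>3. h r) = h 0 + h 1 + h 2 + h (3::nat)"
  by (simp_all add: numeral_eq_Suc)

lemma choose_numeral_small:
  "2 choose 2 = (1::nat)" "3 choose 2 = (3::nat)" "4 choose 2 = (6::nat)" "5 choose 2 = (10::nat)"
  "3 choose 3 = (1::nat)" "4 choose 3 = (4::nat)" "5 choose 3 = (10::nat)" "6 choose 3 = (20::nat)"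
  by (simp_all add: numeral_eq_Suc)

text \<open>
  Rewriting with these facts turns a coefficient of a substituted polynomial, at numeral
  exponents, into an explicit linear combination of coefficients.
\<close>

lemmas subst_eval = subst_yw_def subst_xz_def pole_op_power_sum divided_power_yw_def
    divided_power_xz_def sum_upto_numeral choose_numeral_small

lemma eq_by_cancel:
  fixes d x y :: "'a::idom"
  assumes "d \<noteq> 0" "d * (x - y) = 0"
  shows "x = y"
  using assms by simp

text \<open>
  Since \<open>k\<close> has a pole of order exactly 2, a term in \<open>w\<close> can only be kept regular by a factor
  \<open>x\<^sup>2\<close> or by cancellation inside \<open>u = y - q w\<close>, which the substitution fixes. Degree 3 leaves
  room only for \<open>x\<^sup>2 w\<close> and \<open>x\<^sup>2 y\<close>, besides polynomials in \<open>x, z, q\<close> and the products of \<open>u\<close>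
  with \<open>1, x, z, q\<close>. The listed monomials are those that occur in none of these; the remaining
  equations come from \<open>u\<close>.
\<close>

lemma cubic_regular_subst_yw:
  fixes a :: "'a::field_char_0 coeff_fun"
  assumes "cubic a" and [simp]: "g \<noteq> 0"
    and reg: "\<And>i j l m n. i < 0 \<Longrightarrow> subst_yw b g a i j l m n = 0"
  shows "\<forall>(i, j, l, m, n) \<in> {
      (0, 0, 0, 1, 0), (0, 0, 0, 2, 0), (0, 0, 0, 2, 1), (0, 0, 0, 3, 0), (0, 0, 1, 1, 0),
      (0, 0, 1, 2, 0), (0, 0, 2, 1, 0), (0, 1, 0, 0, 2), (0, 1, 0, 1, 0), (0, 1, 0, 1, 1),
      (0, 1, 0, 2, 0), (0, 1, 1, 0, 1), (0, 1, 1, 1, 0), (0, 1, 2, 0, 0), (0, 2, 0, 0, 0),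
      (0, 2, 0, 0, 1), (0, 2, 0, 1, 0), (0, 2, 1, 0, 0), (0, 3, 0, 0, 0), (1, 0, 0, 1, 0),
      (1, 0, 0, 2, 0), (1, 0, 1, 1, 0), (1, 1, 0, 0, 1), (1, 1, 0, 1, 0), (1, 1, 1, 0, 0),
      (1, 2, 0, 0, 0)}. a i j l m n = 0" (is ?zeros)
    and "a 0 0 0 1 1 = - a 0 1 0 0 0" "a 1 0 0 1 1 = - a 1 1 0 0 0" "a 0 0 0 1 2 = - a 0 1 0 0 1"
        "a 0 0 1 1 1 = - a 0 1 1 0 0"
proof -
  note [simp] = cubicD[OF assms(1)]
  note E = reg and [simp] = subst_eval
  \<comment> \<open>\<open>E[of i j l m n]\<close> is the coefficient of \<open>x\<^sup>i y\<^sup>j z\<^sup>l w\<^sup>m q\<^sup>n\<close> after the substitution. Given the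
    preceding lines, each equation can be solved for the coefficient on its line.\<close>
  have [simp]: "a 0 0 0 3 0 = 0" using E[of "-2" 0 0 2 0] by simp
  have [simp]: "a 0 0 1 2 0 = 0" using E[of "-2" 0 1 1 0] by simp
  have [simp]: "a 0 0 2 1 0 = 0" using E[of "-2" 0 2 0 0] by simp
  have [simp]: "a 0 1 0 2 0 = 0" using E[of "-2" 1 0 1 0] by simp
  have [simp]: "a 0 1 1 1 0 = 0" using E[of "-2" 1 1 0 0] by simp
  have [simp]: "a 0 1 2 0 0 = 0" using E[of "-2" 0 2 0 1] by simp
  have [simp]: "a 0 2 0 1 0 = 0" using E[of "-2" 2 0 0 0] by simp
  have [simp]: "a 0 2 1 0 0 = 0" using E[of "-2" 1 1 0 1] by simp
  have [simp]: "a 0 3 0 0 0 = 0" using E[of "-2" 2 0 0 1] by simp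
  have [simp]: "a 0 0 0 2 0 = 0" using E[of "-2" 0 0 1 0] by simp
  have [simp]: "a 0 0 1 1 0 = 0" using E[of "-2" 0 1 0 0] by simp
  have [simp]: "a 0 1 0 1 0 = 0" using E[of "-2" 1 0 0 0] by simp
  have [simp]: "a 0 1 0 1 1 = 0" using E[of "-2" 0 0 1 2] by simp
  have [simp]: "a 0 1 1 0 1 = 0" using E[of "-2" 0 1 0 2] by simp
  have [simp]: "a 0 2 0 0 1 = 0" using E[of "-2" 1 0 0 2] by simp
  have [simp]: "a 1 0 0 2 0 = 0" using E[of "-1" 0 0 1 0] by simp
  have [simp]: "a 0 0 0 2 1 = 0" using E[of "-2" 0 0 1 1] by simp
  have [simp]: "a 1 0 1 1 0 = 0" using E[of "-1" 0 1 0 0] by simp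
  have [simp]: "a 0 1 0 0 2 = 0" using E[of "-2" 0 0 0 3] by simp
  have [simp]: "a 1 1 0 1 0 = 0" using E[of "-1" 1 0 0 0] by simp
  have [simp]: "a 0 2 0 0 0 = 0" using E[of "-2" 1 0 0 1] by simp
  have [simp]: "a 0 0 0 1 0 = 0" using E[of "-2" 0 0 0 0] by simp
  have [simp]: "a 1 2 0 0 0 = 0" using E[of "-1" 1 0 0 1] by simp
  have [simp]: "a 1 0 0 1 0 = 0" using E[of "-1" 0 0 0 0] by simp
  have [simp]: "a 0 0 0 1 1 = - a 0 1 0 0 0" using E[of "-2" 0 0 0 1]
      by (simp add: eq_neg_iff_add_eq_0 add.commute)
  have [simp]: "a 1 0 0 1 1 = - a 1 1 0 0 0" using E[of "-1" 0 0 0 1]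
      by (simp add: eq_neg_iff_add_eq_0 add.commute)
  have [simp]: "a 0 0 0 1 2 = - a 0 1 0 0 1" using E[of "-2" 0 0 0 2]
      by (simp add: eq_neg_iff_add_eq_0 add.commute)
  have [simp]: "a 1 1 0 0 1 = 0" using E[of "-1" 0 0 0 2] by simp
  have [simp]: "a 0 0 1 1 1 = - a 0 1 1 0 0" using E[of "-2" 0 1 0 1]
      by (simp add: eq_neg_iff_add_eq_0 add.commute)
  have [simp]: "a 1 1 1 0 0 = 0" using E[of "-1" 0 1 0 1] by simp
  show ?zeros
    by simp
  show "a 0 0 0 1 1 = - a 0 1 0 0 0" "a 1 0 0 1 1 = - a 1 1 0 0 0" "a 0 0 0 1 2 = - a 0 1 0 0 1"
      "a 0 0 1 1 1 = - a 0 1 1 0 0"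
    by simp_all
qed

text \<open>
  The substitution sends \<open>x y\<close> to \<open>x y + c q\<close> and \<open>z y\<close> to \<open>z y + c w\<close>, and it fixes \<open>y, w, q\<close>
  and \<open>x w - z q\<close>. The regular cubics are spanned by the polynomials in \<open>y, w, q\<close>, by the
  multiples of \<open>x y\<close>, \<open>z y\<close> and \<open>x w - z q\<close> by \<open>1, y, w, q\<close> that have degree at most 3, and by
  \<open>x (x y - c q)\<close>, \<open>x (z y - c w)\<close> and \<open>z (z y - c w)\<close>: here \<open>x y - c q\<close> and \<open>z y - c w\<close> become
  multiples of \<open>y\<close>, which absorb the pole of \<open>x\<close> or \<open>z\<close>.
\<close>

lemma cubic_regular_subst_xz:
  fixes a :: "'a::field_char_0 coeff_fun"
  assumes "cubic a" and [simp]: "c \<noteq> 0"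
    and reg: "\<And>i j l m n. j < 0 \<Longrightarrow> subst_xz c a i j l m n = 0"
  shows "\<forall>(i, j, l, m, n) \<in> {
      (0, 0, 1, 0, 0), (0, 0, 1, 2, 0), (0, 0, 2, 0, 0), (0, 0, 2, 0, 1), (0, 0, 2, 1, 0),
      (0, 0, 3, 0, 0), (1, 0, 0, 0, 0), (1, 0, 0, 0, 2), (1, 0, 1, 0, 0), (1, 0, 1, 0, 1),
      (1, 0, 1, 1, 0), (1, 0, 2, 0, 0), (2, 0, 0, 0, 0), (2, 0, 0, 0, 1), (2, 0, 0, 1, 0),
      (2, 0, 1, 0, 0), (3, 0, 0, 0, 0)}. a i j l m n = 0" (is ?zeros)
    and "a 0 0 1 0 2 = - a 1 0 0 1 1" "a 0 0 1 1 0 = - c * a 0 1 2 0 0"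
        "a 1 0 0 2 0 = - a 0 0 1 1 1" "a 1 0 0 0 1 = - c * a 2 1 0 0 0"
        "a 1 0 0 1 0 = - a 0 0 1 0 1 - c * a 1 1 1 0 0"
proof -
  note [simp] = cubicD[OF assms(1)]
  note E = reg and [simp] = subst_eval
  \<comment> \<open>The first index of \<open>E[of j i l m n]\<close> is the exponent of \<open>y\<close>, the only one that is negative.\<close>
  have [simp]: "a 0 0 1 0 0 = 0" using E[of "-1" 0 0 1 0] by simp
  have [simp]: "a 0 0 1 2 0 = 0" using E[of "-1" 0 0 3 0] by simp
  have [simp]: "a 0 0 2 0 0 = 0" using E[of "-1" 0 1 1 0] by simp
  have [simp]: "a 0 0 2 1 0 = 0" using E[of "-1" 0 1 2 0] by simp
  have [simp]: "a 0 0 3 0 0 = 0" using E[of "-1" 0 2 1 0] by simp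
  have [simp]: "a 1 0 0 0 0 = 0" using E[of "-1" 0 0 0 1] by simp
  have [simp]: "a 1 0 0 0 2 = 0" using E[of "-1" 0 0 0 3] by simp
  have [simp]: "a 1 0 1 0 0 = 0" using E[of "-1" 1 0 1 0] by simp
  have [simp]: "a 1 0 1 0 1 = 0" using E[of "-1" 0 1 0 2] by simp
  have [simp]: "a 1 0 1 1 0 = 0" using E[of "-1" 1 0 2 0] by simp
  have [simp]: "a 1 0 2 0 0 = 0" using E[of "-1" 1 1 1 0] by simp
  have [simp]: "a 2 0 0 0 0 = 0" using E[of "-1" 1 0 0 1] by simp
  have [simp]: "a 2 0 0 0 1 = 0" using E[of "-1" 1 0 0 2] by simp
  have [simp]: "a 2 0 1 0 0 = 0" using E[of "-1" 2 0 1 0] by simp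
  have [simp]: "a 3 0 0 0 0 = 0" using E[of "-1" 2 0 0 1] by simp
  have [simp]: "a 0 0 2 0 1 = 0" using E[of "-1" 0 1 1 1] by simp
  have [simp]: "a 2 0 0 1 0 = 0" using E[of "-1" 1 0 1 1] by simp
  have [simp]: "a 0 0 1 0 2 = - a 1 0 0 1 1" using E[of "-1" 0 0 1 2]
      by (simp add: eq_neg_iff_add_eq_0 add.commute)
  have [simp]: "a 0 0 1 1 0 = - c * a 0 1 2 0 0"
    by (rule eq_by_cancel[of c]) (use E[of "-1" 0 0 2 0] in \<open>simp_all add: algebra_simps
        power2_eq_square\<close>)
  have [simp]: "a 1 0 0 2 0 = - a 0 0 1 1 1" using E[of "-1" 0 0 2 1]
      by (simp add: eq_neg_iff_add_eq_0 add.commute)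
  have [simp]: "a 1 0 0 0 1 = - c * a 2 1 0 0 0"
    by (rule eq_by_cancel[of c]) (use E[of "-1" 0 0 0 2] in \<open>simp_all add: algebra_simps
        power2_eq_square\<close>)
  have [simp]: "a 1 0 0 1 0 = - a 0 0 1 0 1 - c * a 1 1 1 0 0"
    by (rule eq_by_cancel[of c]) (use E[of "-1" 0 0 1 1] in \<open>simp_all add: algebra_simps
        power2_eq_square\<close>)
  show ?zeros
    by simp
  show "a 0 0 1 0 2 = - a 1 0 0 1 1" "a 0 0 1 1 0 = - c * a 0 1 2 0 0" "a 1 0 0 2 0 = - a 0 0 1 1 1"
      "a 1 0 0 0 1 = - c * a 2 1 0 0 0" "a 1 0 0 1 0 = - a 0 0 1 0 1 - c * a 1 1 1 0 0"
    by simp_all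
qed

definition single_coeff :: "'a::zero \<Rightarrow> int \<times> int \<times> int \<times> int \<times> int \<Rightarrow> 'a coeff_fun" where
  "single_coeff t e i j l m n = (if (i, j, l, m, n) = e then t else 0)"

lemma cubic_single_coeff:
  assumes "0 \<le> i" "0 \<le> j" "0 \<le> l" "0 \<le> m" "0 \<le> n" "i + j + l + m + n \<le> 3"
  shows "cubic (single_coeff t (i, j, l, m, n))"
  using assms by (simp add: cubic_def single_coeff_def)

lemma cubic_add:
  fixes a a' :: "'a::comm_monoid_add coeff_fun"
  assumes "cubic a" "cubic a'"
  shows "cubic (\<lambda>i j l m n. a i j l m n + a' i j l m n)"
  unfolding cubic_def
proof (intro allI impI)
  fix i j l m n
  assume "a i j l m n + a' i j l m n \<noteq> 0"
  then have "a i j l m n \<noteq> 0 \<or> a' i j l m n \<noteq> 0" by auto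
  then show "0 \<le> i \<and> 0 \<le> j \<and> 0 \<le> l \<and> 0 \<le> m \<and> 0 \<le> n \<and> i + j + l + m + n \<le> 3"
    using assms unfolding cubic_def by blast
qed

lemma upto_small: "[0..3] = [0, 1, 2, 3::int]" "[0..2] = [0, 1, 2::int]" "[0..1] = [0, 1::int]"
  by (simp_all add: upto_rec1)

text \<open>
  The 56 exponents of degree at most 3 are enumerated by explicit lists, so that rewriting can
  run through them.
\<close>

lemma cubic_eqI:
  assumes "cubic a" "cubic a'"
    and eq: "list_all (\<lambda>i. list_all (\<lambda>j. list_all (\<lambda>l. list_all (\<lambda>m. list_all (\<lambda>n.
      a i j l m n = a' i j l m n) [0..3 - i - j - l - m]) [0..3 - i - j - l]) [0..3 - i - j]) [0..3
          - i]) [0..3]"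
  shows "a = a'"
proof (intro ext)
  fix i j l m n
  show "a i j l m n = a' i j l m n"
  proof (cases "0 \<le> i \<and> 0 \<le> j \<and> 0 \<le> l \<and> 0 \<le> m \<and> 0 \<le> n \<and> i + j + l + m + n \<le> 3")
    case True
    then show ?thesis using eq by (simp add: list_all_iff)
  next
    case False
    then have "a i j l m n = 0" "a' i j l m n = 0"
      using assms(1,2) unfolding cubic_def by blast+
    then show ?thesis by simp
  qed
qed

text \<open>
  Exchanging \<open>x\<close> with \<open>z\<close> and \<open>w\<close> with \<open>q\<close> maps the substitution of chart 0 to that of chart 2
  with other parameters, and preserves that of chart 1.
\<close>

definition swap :: "'a coeff_fun \<Rightarrow> 'a coeff_fun" where
  "swap a i j l m n = a l j i n m"

lemma subst_xz_swap:
  fixes a :: "'a::comm_ring_1 coeff_fun"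
  shows "subst_xz c (swap a) i j l m n = subst_xz c a l j i n m"
  by (simp add: subst_eval swap_def algebra_simps)

lemma cubic_swap:
  assumes "cubic a"
  shows "cubic (swap a)"
  unfolding cubic_def swap_def
proof (intro allI impI)
  fix i j l m n
  assume "a l j i n m \<noteq> 0"
  with assms have "0 \<le> l \<and> 0 \<le> j \<and> 0 \<le> i \<and> 0 \<le> n \<and> 0 \<le> m \<and> l + j + i + n + m \<le> 3"
    unfolding cubic_def by blast
  then show "0 \<le> i \<and> 0 \<le> j \<and> 0 \<le> l \<and> 0 \<le> m \<and> 0 \<le> n \<and> i + j + l + m + n \<le> 3"
    by linarith
qed

lemma swap_swap: "swap (swap a) = a"
  by (simp add: swap_def fun_eq_iff)

section \<open>The linear system for the coefficients\<close>

lemmas ring_nf = algebra_simps power2_eq_square power3_eq_cube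

text \<open>
  The conditions of chart 2, where \<open>a1, \<dots>, a5\<close> are the coefficients of the right-hand sides for
  \<open>x, y, z, w, q\<close>: first those of the unmoved coordinates \<open>x, z, q\<close>, then those of \<open>w\<close> and \<open>y\<close>.
  Multiplication by \<open>-k' = b/x\<^sup>2 + 2 g/x\<^sup>3\<close> raises the index at which a coefficient is read by 2
  or 3.
\<close>

definition regular_along_x :: "'a::comm_ring_1 \<Rightarrow> 'a \<Rightarrow> 'a coeff_fun \<Rightarrow> 'a coeff_fun \<Rightarrow> 'a coeff_fun
    \<Rightarrow> 'a coeff_fun \<Rightarrow> 'a coeff_fun \<Rightarrow> bool" where
  "regular_along_x b g a1 a2 a3 a4 a5 \<longleftrightarrow> (\<forall>i j l m n. i < 0 \<longrightarrow>
     subst_yw b g a1 i j l m n = 0 \<and> subst_yw b g a3 i j l m n = 0 \<and> subst_yw b g a5 i j l m n = 0 \<and>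
     subst_yw b g a4 i j l m n
       + (b * subst_yw b g a1 (i + 2) j l m n + 2 * g * subst_yw b g a1 (i + 3) j l m n) = 0 \<and>
     subst_yw b g a2 i j l m n
       - (b * subst_yw b g a5 (i + 1) j l m n + g * subst_yw b g a5 (i + 2) j l m n)
       + (b * subst_yw b g a1 (i + 2) j l m (n - 1) + 2 * g * subst_yw b g a1 (i + 3) j l m (n - 1))
           = 0)"

text \<open>
  The conditions of chart 1: those of the unmoved coordinates \<open>y, w, q\<close>, then those of \<open>x\<close> and
  \<open>z\<close>.
\<close>

definition regular_along_y :: "'a::comm_ring_1 \<Rightarrow> 'a coeff_fun \<Rightarrow> 'a coeff_fun \<Rightarrow> 'a coeff_fun
    \<Rightarrow> 'a coeff_fun \<Rightarrow> 'a coeff_fun \<Rightarrow> bool" where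
  "regular_along_y c a1 a2 a3 a4 a5 \<longleftrightarrow> (\<forall>i j l m n. j < 0 \<longrightarrow>
     subst_xz c a2 i j l m n = 0 \<and> subst_xz c a4 i j l m n = 0 \<and> subst_xz c a5 i j l m n = 0 \<and>
     subst_xz c a1 i j l m n - c * subst_xz c a5 i (j + 1) l m n
         + c * subst_xz c a2 i (j + 2) l m (n - 1) = 0 \<and>
     subst_xz c a3 i j l m n - c * subst_xz c a4 i (j + 1) l m n
         + c * subst_xz c a2 i (j + 2) l (m - 1) n = 0)"

locale regular_cubic_system =
  fixes b0 g0 b2 g2 c :: "'a::field_char_0" and a1 a2 a3 a4 a5 :: "'a coeff_fun"
  assumes cubic: "cubic a1" "cubic a2" "cubic a3" "cubic a4" "cubic a5"
    and nz: "g0 \<noteq> 0" "g2 \<noteq> 0" "c \<noteq> 0"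
    and chart0: "regular_along_x b0 g0 (swap a3) (swap a2) (swap a1) (swap a5) (swap a4)"
    and chart1: "regular_along_y c a1 a2 a3 a4 a5"
    and chart2: "regular_along_x b2 g2 a1 a2 a3 a4 a5"
begin

text \<open>
  The symmetry exchanges charts 0 and 2, so that each consequence drawn for the pair \<open>x, w\<close>
  holds for the pair \<open>z, q\<close>.
\<close>

lemma dual: "regular_cubic_system b2 g2 b0 g0 c (swap a3) (swap a2) (swap a1) (swap a5) (swap a4)"
proof
  show "regular_along_y c (swap a3) (swap a2) (swap a1) (swap a5) (swap a4)"
    using chart1 unfolding regular_along_y_def subst_xz_swap by blast
qed (use cubic nz chart0 chart2 in \<open>simp_all add: cubic_swap swap_swap\<close>)

lemma chart1_dx: "subst_xz c a1 i j l m n - c * subst_xz c a5 i (j + 1) l m n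
    + c * subst_xz c a2 i (j + 2) l m (n - 1) = 0"
  and chart1_dz: "subst_xz c a3 i j l m n - c * subst_xz c a4 i (j + 1) l m n
      + c * subst_xz c a2 i (j + 2) l (m - 1) n = 0"
  and chart1_invariant: "subst_xz c a2 i j l m n = 0" "subst_xz c a4 i j l m n = 0"
      "subst_xz c a5 i j l m n = 0"
  if "j < 0"
  using that chart1 unfolding regular_along_y_def by blast+

lemma chart2_dw: "subst_yw b2 g2 a4 i j l m n
       + (b2 * subst_yw b2 g2 a1 (i + 2) j l m n + 2 * g2 * subst_yw b2 g2 a1 (i + 3) j l m n) = 0"
  and chart2_dy: "subst_yw b2 g2 a2 i j l m n
       - (b2 * subst_yw b2 g2 a5 (i + 1) j l m n + g2 * subst_yw b2 g2 a5 (i + 2) j l m n)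
       + (b2 * subst_yw b2 g2 a1 (i + 2) j l m (n - 1)
           + 2 * g2 * subst_yw b2 g2 a1 (i + 3) j l m (n - 1)) = 0"
  and chart2_invariant: "subst_yw b2 g2 a1 i j l m n = 0" "subst_yw b2 g2 a3 i j l m n = 0"
      "subst_yw b2 g2 a5 i j l m n = 0"
  if "i < 0"
  using that chart2 unfolding regular_along_x_def by blast+

lemma chart0_invariant:
  assumes "i < 0"
  shows "subst_yw b0 g0 (swap a1) i j l m n = 0" "subst_yw b0 g0 (swap a3) i j l m n = 0"
      "subst_yw b0 g0 (swap a4) i j l m n = 0"
  using assms chart0 unfolding regular_along_x_def by blast+

text \<open>
  Every coordinate is left unmoved by one or two of the charts, and each such chart constrains
  the shape of the right-hand side of that coordinate.
\<close>

lemmas shape1 =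
  cubic_regular_subst_yw[OF cubic(1) nz(2) chart2_invariant(1), simplified]
  cubic_regular_subst_yw[OF cubic_swap[OF cubic(1)] nz(1) chart0_invariant(1), simplified, unfolded
      swap_def]
lemmas shape2 = cubic_regular_subst_xz[OF cubic(2) nz(3) chart1_invariant(1), simplified]
lemmas shape3 =
  cubic_regular_subst_yw[OF cubic(3) nz(2) chart2_invariant(2), simplified]
  cubic_regular_subst_yw[OF cubic_swap[OF cubic(3)] nz(1) chart0_invariant(2), simplified, unfolded
      swap_def]
lemmas shape4 =
  cubic_regular_subst_xz[OF cubic(4) nz(3) chart1_invariant(2), simplified]
  cubic_regular_subst_yw[OF cubic_swap[OF cubic(4)] nz(1) chart0_invariant(3), simplified, unfolded
      swap_def]
lemmas shape5 =
  cubic_regular_subst_xz[OF cubic(5) nz(3) chart1_invariant(3), simplified]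
  cubic_regular_subst_yw[OF cubic(5) nz(2) chart2_invariant(3), simplified]

text \<open>
  Consequences of the two shapes of \<open>a4\<close> and of \<open>a5\<close> together, where the relations from one
  chart meet the vanishing from the other.
\<close>

lemma shape45:
  "a5 0 0 1 0 1 = 0" "a5 0 0 1 1 1 = 0" "a5 0 1 1 0 0 = 0"
  "a4 1 0 0 1 0 = 0" "a4 1 0 0 1 1 = 0" "a4 1 1 0 0 0 = 0"
  using shape4 shape5 by simp_all

text \<open>
  In chart 2, regularity of \<open>dw/dt\<close> requires that the poles of \<open>k' \<cdot> f\<^sub>x\<close>, of order up to 3, be
  cancelled by the poles in \<open>f\<^sub>w\<close>. This removes most of \<open>f\<^sub>x\<close> and expresses the coefficients of
  \<open>f\<^sub>w\<close> through those of \<open>x\<^sup>2 w\<close>, \<open>x\<close> and \<open>x y\<close> in \<open>f\<^sub>x\<close>.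
\<close>

lemma shape_xw:
  shows
    "a1 0 1 0 0 0 = 0" "a4 0 0 0 3 0 = 0" "a1 0 0 1 0 0 = 0" "a1 0 1 1 0 0 = 0" "a1 0 0 2 0 0 = 0"
    "a1 0 0 2 0 1 = 0" "a1 0 0 3 0 0 = 0" "a4 0 0 0 2 0 = 0" "a1 1 0 2 0 0 = 0" "a4 0 1 2 0 0 = 0"
    "a1 1 0 1 0 0 = 0" "a1 2 0 1 0 0 = 0" "a4 0 1 0 1 0 = - 2 * a1 1 1 0 0 0"
    "a4 0 1 1 0 0 = - a1 2 0 0 1 0" "a1 0 0 0 0 0 = - g2 * a1 2 0 0 1 0 / 2"
    "a4 0 0 0 1 0 = - b2 * a1 2 0 0 1 0 / 2 - 2 * a1 1 0 0 0 0"
proof -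
  note [simp] = nz shape1 shape4 cubicD[OF cubic(1)] cubicD[OF cubic(4)] subst_eval
  have [simp]: "a1 0 1 0 0 0 = 0" using chart2_dw[of "-3" 0 0 1 1] by simp
  have [simp]: "a4 0 0 0 3 0 = 0" using chart2_dw[of "-2" 0 0 2 0] by simp
  have [simp]: "a1 0 0 1 0 0 = 0" using chart2_dw[of "-3" 0 1 0 0] by simp
  have [simp]: "a1 0 1 1 0 0 = 0" using chart2_dw[of "-3" 0 1 1 1] by simp
  have [simp]: "a1 0 0 2 0 0 = 0" using chart2_dw[of "-3" 0 2 0 0] by simp
  have [simp]: "a1 0 0 2 0 1 = 0" using chart2_dw[of "-3" 0 2 0 1] by simp
  have [simp]: "a1 0 0 3 0 0 = 0" using chart2_dw[of "-3" 0 3 0 0] by simp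
  have [simp]: "a4 0 0 0 2 0 = 0" using chart2_dw[of "-2" 0 0 1 0] by simp
  have [simp]: "a1 1 0 2 0 0 = 0" using chart2_dw[of "-2" 0 2 0 0] by simp
  have [simp]: "a4 0 1 2 0 0 = 0" using chart2_dw[of "-2" 0 2 0 1] by simp
  have [simp]: "a1 1 0 1 0 0 = 0" using chart2_dw[of "-2" 0 1 0 0] by simp
  have [simp]: "a1 2 0 1 0 0 = 0" using chart2_dw[of "-1" 0 1 0 0] by simp
  have [simp]: "a4 0 1 0 1 0 = - 2 * a1 1 1 0 0 0"
    by (rule eq_by_cancel[of "- g2"]) (use chart2_dw[of "-2" 0 0 1 1] in \<open>simp_all add: ring_nf\<close>)
  have [simp]: "a4 0 1 1 0 0 = - a1 2 0 0 1 0"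
    by (rule eq_by_cancel[of "2 * g2"]) (use chart2_dw[of "-1" 0 0 1 0] in \<open>simp_all add: ring_nf\<close>)
  have [simp]: "a1 0 0 0 0 0 = - g2 * a1 2 0 0 1 0 / 2"
    by (rule eq_by_cancel[of "2 * g2"]) (use chart2_dw[of "-3" 0 0 0 0] in \<open>simp_all add: ring_nf\<close>)
  have [simp]: "a4 0 0 0 1 0 = - b2 * a1 2 0 0 1 0 / 2 - 2 * a1 1 0 0 0 0"
    by (rule eq_by_cancel[of "g2"]) (use chart2_dw[of "-2" 0 0 0 0] in \<open>simp_all add: ring_nf\<close>)
  show
    "a1 0 1 0 0 0 = 0" "a4 0 0 0 3 0 = 0" "a1 0 0 1 0 0 = 0" "a1 0 1 1 0 0 = 0" "a1 0 0 2 0 0 = 0"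
    "a1 0 0 2 0 1 = 0" "a1 0 0 3 0 0 = 0" "a4 0 0 0 2 0 = 0" "a1 1 0 2 0 0 = 0" "a4 0 1 2 0 0 = 0"
    "a1 1 0 1 0 0 = 0" "a1 2 0 1 0 0 = 0" "a4 0 1 0 1 0 = - 2 * a1 1 1 0 0 0"
    "a4 0 1 1 0 0 = - a1 2 0 0 1 0" "a1 0 0 0 0 0 = - g2 * a1 2 0 0 1 0 / 2"
    "a4 0 0 0 1 0 = - b2 * a1 2 0 0 1 0 / 2 - 2 * a1 1 0 0 0 0"
    by simp_all
qed

lemmas shape_zq = regular_cubic_system.shape_xw[OF dual, unfolded swap_def]

text \<open>
  The shapes and the two relations \<open>shape_xw\<close> and \<open>shape_zq\<close> leave few unknowns besides those of
  \<open>f\<^sub>y\<close>. Chart 1 expresses most of them through \<open>f\<^sub>y\<close>, and chart 2 then reduces \<open>f\<^sub>y\<close> to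
  multiples of its coefficient \<open>k\<close> of \<open>x y w\<close>.
\<close>

theorem coefficients:
  obtains k where
    "a1 = (\<lambda>i j l m n. single_coeff (- k) (2, 0, 0, 1, 0) i j l m n
        + single_coeff (k * b2 / 2) (1, 0, 0, 0, 0) i j l m n
       + single_coeff (k * g2 / 2) (0, 0, 0, 0, 0) i j l m n)"
    "a2 = (\<lambda>i j l m n. single_coeff k (1, 1, 0, 1, 0) i j l m n
        + single_coeff k (0, 1, 1, 0, 1) i j l m n
       + single_coeff (- (k * (b0 / 2 - c + b2 / 2))) (0, 1, 0, 0, 0) i j l m n
           + single_coeff (- (k * c)) (0, 0, 0, 1, 1) i j l m n)"
    "a3 = (\<lambda>i j l m n. single_coeff (- k) (0, 0, 2, 0, 1) i j l m n
        + single_coeff (k * b0 / 2) (0, 0, 1, 0, 0) i j l m n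
       + single_coeff (k * g0 / 2) (0, 0, 0, 0, 0) i j l m n)"
    "a4 = (\<lambda>i j l m n. single_coeff k (1, 0, 0, 2, 0) i j l m n
        + single_coeff (- k) (0, 0, 1, 1, 1) i j l m n
       + single_coeff (- (k * b2 / 2)) (0, 0, 0, 1, 0) i j l m n
           + single_coeff k (0, 1, 1, 0, 0) i j l m n)"
    "a5 = (\<lambda>i j l m n. single_coeff k (0, 0, 1, 0, 2) i j l m n
        + single_coeff (- k) (1, 0, 0, 1, 1) i j l m n
       + single_coeff (- (k * b0 / 2)) (0, 0, 0, 0, 1) i j l m n
           + single_coeff k (1, 1, 0, 0, 0) i j l m n)"
proof -
  note [simp] = nz shape1 shape2 shape3 shape4 shape5 shape45 cubicD[OF cubic(1)] cubicD[OF
      cubic(2)] cubicD[OF cubic(3)]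
    cubicD[OF cubic(4)] cubicD[OF cubic(5)] shape_xw shape_zq subst_eval
  \<comment> \<open>In chart 1, the double pole of \<open>k' \<cdot> f\<^sub>y\<close> has to be cancelled by \<open>f\<^sub>x\<close> and \<open>k \<cdot> f\<^sub>q\<close>. The
    first index is the exponent of \<open>y\<close>, and each equation is solved for the coefficient on
    its line.\<close>
  have [simp]: "a5 0 0 0 0 0 = 0" using chart1_dx[of "-1" 0 0 0 0] by (simp add: ring_nf)
  have [simp]: "a2 0 0 0 0 0 = 0" using chart1_dx[of "-2" 0 0 0 1] by (simp add: ring_nf)
  have [simp]: "a2 0 1 0 0 2 = 0" using chart1_dx[of "-1" 0 0 0 3] by (simp add: ring_nf)
  have [simp]: "a2 0 0 0 0 3 = 0" using chart1_dx[of "-2" 0 0 0 4] by (simp add: ring_nf)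
  have [simp]: "a2 0 0 0 1 2 = 0" using chart1_dx[of "-2" 0 0 1 3] by (simp add: ring_nf)
  have [simp]: "a2 0 1 0 2 0 = 0" using chart1_dx[of "-1" 0 0 2 1] by (simp add: ring_nf)
  have [simp]: "a2 0 0 0 2 1 = 0" using chart1_dx[of "-2" 0 0 2 2] by (simp add: ring_nf)
  have [simp]: "a2 0 0 0 3 0 = 0" using chart1_dx[of "-2" 0 0 3 1] by (simp add: ring_nf)
  have [simp]: "a2 0 1 1 0 0 = 0" using chart1_dx[of "-1" 0 1 0 1] by (simp add: ring_nf)
  have [simp]: "a2 1 0 0 1 1 = 0" using chart1_dx[of "-2" 0 1 0 3] by (simp add: ring_nf)
  have [simp]: "a2 0 1 2 0 0 = 0" using chart1_dx[of "-2" 0 1 1 1] by (simp add: ring_nf)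
  have [simp]: "a2 0 1 1 1 0 = 0" using chart1_dx[of "-1" 0 1 1 1] by (simp add: ring_nf)
  have [simp]: "a2 0 0 1 1 1 = 0" using chart1_dx[of "-2" 0 1 1 2] by (simp add: ring_nf)
  have [simp]: "a1 3 0 0 0 0 = 0" using chart1_dx[of "-3" 0 0 0 3] by (simp add: ring_nf)
  have [simp]: "a2 1 1 0 0 1 = 0" using chart1_dx[of "-1" 1 0 0 2] by (simp add: ring_nf)
  have [simp]: "a2 0 0 1 0 1 = 0" using chart1_dx[of "-2" 1 0 1 1] by (simp add: ring_nf)
  have [simp]: "a2 1 1 1 0 0 = 0" using chart1_dx[of "-1" 1 1 0 1] by (simp add: ring_nf)
  have [simp]: "a2 0 0 0 0 2 = 0" using chart1_dx[of "-2" 0 0 0 3] by (simp add: ring_nf)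
  have [simp]: "a2 0 0 0 1 0 = 0" using chart1_dx[of "-2" 0 0 1 1] by (simp add: ring_nf)
  have [simp]: "a2 0 0 0 2 0 = 0" using chart1_dx[of "-2" 0 0 2 1] by (simp add: ring_nf)
  have [simp]: "a2 2 1 0 0 0 = 0" using chart1_dx[of "-2" 1 0 0 2] by (simp add: ring_nf)
  have [simp]: "a2 0 1 0 0 1 = - c * a2 1 2 0 0 0"
    by (rule eq_by_cancel[of "c"]) (use chart1_dx[of "-1" 0 0 0 2] in \<open>simp_all add: ring_nf\<close>)
  have [simp]: "a3 0 0 2 0 1 = - a2 0 1 1 0 1"
    by (rule eq_by_cancel[of "c"]) (use chart1_dx[of "-1" 0 1 0 2] in \<open>simp_all add: ring_nf\<close>)
  have [simp]: "a1 2 0 0 0 0 = - a2 1 1 0 0 0 / 2"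
    by (rule eq_by_cancel[of "2 * c"]) (use chart1_dx[of "-1" 1 0 0 1] in \<open>simp_all add: ring_nf\<close>)
  have [simp]: "a2 0 0 0 0 1 = - c * a2 1 1 0 0 0 / 2"
    by (rule eq_by_cancel[of "c"]) (use chart1_dx[of "-2" 0 0 0 2] in \<open>simp_all add: ring_nf\<close>)
  have [simp]: "a5 0 1 0 0 0 = - c * a2 0 2 1 0 0 - a2 0 1 0 1 0"
    by (rule eq_by_cancel[of "c"]) (use chart1_dx[of "-1" 0 0 1 1] in \<open>simp_all add: ring_nf\<close>)
  have [simp]: "a3 0 1 1 0 0 = a2 0 1 0 1 1 / 2 - a1 1 1 0 0 0 / 2"
    by (rule eq_by_cancel[of "- 2 * c"]) (use chart1_dx[of "-1" 0 0 1 2] in \<open>simp_all add: ring_nf\<close>)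
  have [simp]: "a1 2 0 0 1 0 = - a2 1 1 0 1 0 / 2 - a2 0 1 1 0 1 / 2"
    by (rule eq_by_cancel[of "2 * c"]) (use chart1_dx[of "-1" 1 0 1 1] in \<open>simp_all add: ring_nf\<close>)
  have [simp]: "a2 0 0 0 1 1 = - c * a2 0 1 1 0 1 / 2 - c * a2 1 1 0 1 0 / 2"
    by (rule eq_by_cancel[of "c"]) (use chart1_dx[of "-2" 0 0 1 2] in \<open>simp_all add: ring_nf\<close>)
  have [simp]: "a3 0 0 1 0 0 = (c / 2 + b0 / 4) * a2 0 1 1 0 1 - a1 1 0 0 0 0 / 2
      - a2 0 1 0 0 0 / 2"
    by (rule eq_by_cancel[of "2 * c"]) (use chart1_dx[of "-1" 0 0 0 1] in \<open>simp_all add: ring_nf\<close>)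
  \<comment> \<open>The same for \<open>f\<^sub>z\<close> and \<open>f\<^sub>w\<close>. This relates the two halves of the system to each other.\<close>
  have [simp]: "a4 0 0 0 0 0 = 0" using chart1_dz[of "-1" 0 0 0 0] by (simp add: ring_nf)
  have [simp]: "a3 0 0 2 0 0 = 0" using chart1_dz[of "-2" 0 0 2 0] by (simp add: ring_nf)
  have [simp]: "a4 0 1 0 0 0 = 0" using chart1_dz[of "-1" 0 0 1 1] by (simp add: ring_nf)
  have [simp]: "a3 0 0 3 0 0 = 0" using chart1_dz[of "-2" 0 1 2 0] by (simp add: ring_nf)
  have [simp]: "a2 0 1 1 0 1 = a2 1 1 0 1 0"
    by (rule eq_by_cancel[of "- c * c / 2"]) (use chart1_dz[of
        "-2" 0 0 2 1] in \<open>simp_all add: ring_nf\<close>)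
  have [simp]: "a2 0 1 0 1 0 = - c * a2 0 2 1 0 0"
    by (rule eq_by_cancel[of "c"]) (use chart1_dz[of "-1" 0 0 2 0] in \<open>simp_all add: ring_nf\<close>)
  have [simp]: "a1 1 1 0 0 0 = a2 0 1 0 1 1 / 3"
    by (rule eq_by_cancel[of "- 3 * c / 2"]) (use chart1_dz[of
        "-1" 0 0 2 1] in \<open>simp_all add: ring_nf\<close>)
  \<comment> \<open>Regularity of \<open>dy/dt\<close> in chart 2 removes the terms of \<open>f\<^sub>y\<close> that chart 1 leaves undetermined,
    and fixes the coefficient of \<open>x\<close> in \<open>f\<^sub>x\<close>.\<close>
  have [simp]: "a2 0 2 1 0 0 = 0" using chart2_dy[of "-2" 0 0 1 1] by (simp add: ring_nf)
  have [simp]: "a2 0 2 0 1 0 = 0" using chart2_dy[of "-4" 0 0 1 2] by (simp add: ring_nf)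
  have [simp]: "a2 0 3 0 0 0 = 0" using chart2_dy[of "-4" 1 0 0 2] by (simp add: ring_nf)
  have [simp]: "a2 0 1 0 1 1 = 0" using chart2_dy[of "-2" 0 0 1 2] by (simp add: ring_nf)
  have [simp]: "a2 0 2 0 0 1 = 0" using chart2_dy[of "-4" 0 0 0 3] by (simp add: ring_nf)
  have [simp]: "a2 0 2 0 0 0 = 0" using chart2_dy[of "-4" 0 0 0 2] by (simp add: ring_nf)
  have [simp]: "a2 1 2 0 0 0 = 0" using chart2_dy[of "-3" 0 0 0 2] by (simp add: ring_nf)
  have [simp]: "a1 1 0 0 0 0 = b2 * a2 1 1 0 1 0 / 2"
    by (rule eq_by_cancel[of "g2"]) (use chart2_dy[of "-2" 0 0 0 1] in \<open>simp_all add: ring_nf\<close>)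
  have [simp]: "a2 0 1 0 0 0 = (c - b2 / 2 - b0 / 2) * a2 1 1 0 1 0"
    by (rule eq_by_cancel[of "c / 2"]) (use chart1_dz[of "-1" 0 0 1 0] in \<open>simp_all add: ring_nf\<close>)
  have [simp]: "a2 1 1 0 0 0 = 0" using chart1_dz[of "-2" 0 0 1 1] by (simp add: ring_nf)
  show ?thesis
    by (rule that[of "a2 1 1 0 1 0"]; rule cubic_eqI; (intro cubic cubic_add cubic_single_coeff)?;
        simp add: single_coeff_def upto_small field_simps)
qed

end

section \<open>The three charts\<close>

definition mk_expo :: "int \<Rightarrow> int \<Rightarrow> int \<Rightarrow> int \<Rightarrow> int \<Rightarrow> expo" where
  "mk_expo i j l m n = (\<lambda>v. case v of cX \<Rightarrow> i | cY \<Rightarrow> j | cZ \<Rightarrow> l | cW \<Rightarrow> m | cQ \<Rightarrow> n)"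

definition coeff_fun :: "pol \<Rightarrow> ratt coeff_fun" where
  "coeff_fun p i j l m n = pol_coeff p (mk_expo i j l m n)"

lemma mk_expo_eqI:
  "\<mu> cX = i \<Longrightarrow> \<mu> cY = j \<Longrightarrow> \<mu> cZ = l \<Longrightarrow> \<mu> cW = m \<Longrightarrow> \<mu> cQ = n \<Longrightarrow> \<mu> = mk_expo i j l m n"
  by (auto simp: mk_expo_def fun_eq_iff split: coord.split)

lemma mk_expo_apply [simp]:
  "mk_expo i j l m n cX = i" "mk_expo i j l m n cY = j" "mk_expo i j l m n cZ = l"
      "mk_expo i j l m n cW = m" "mk_expo i j l m n cQ = n"
  by (simp_all add: mk_expo_def)

lemma mk_expo_upd:
  "(mk_expo i j l m n)(cX := k) = mk_expo k j l m n"
  "(mk_expo i j l m n)(cY := k) = mk_expo i k l m n"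
  "(mk_expo i j l m n)(cZ := k) = mk_expo i j k m n"
  by (rule mk_expo_eqI; simp)+

lemma mk_expo_minus_unit:
  "mk_expo i j l m n - unit_expo cW = mk_expo i j l (m - 1) n"
  "mk_expo i j l m n - unit_expo cQ = mk_expo i j l m (n - 1)"
  by (rule mk_expo_eqI; simp add: unit_expo_def)+

lemma cubic_coeff_fun:
  assumes "tdegree p \<le> 3"
  shows "cubic (coeff_fun p)"
  unfolding cubic_def
proof (intro allI impI)
  fix i j l m n
  assume nz: "coeff_fun p i j l m n \<noteq> 0"
  have "(\<forall>v. 0 \<le> mk_expo i j l m n v) \<and> (\<Sum>v\<in>UNIV. mk_expo i j l m n v) \<le> int (tdegree p)"
    using nz pol_coeff_degree[of "mk_expo i j l m n" p] unfolding coeff_fun_def by (meson not_less)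
  then have "\<forall>v. 0 \<le> mk_expo i j l m n v" "(\<Sum>v\<in>UNIV. mk_expo i j l m n v) \<le> 3"
    using assms by auto
  from this(1)[rule_format, of cX] this(1)[rule_format, of cY] this(1)[rule_format, of cZ]
    this(1)[rule_format, of cW] this(1)[rule_format, of cQ] this(2)
  show "0 \<le> i \<and> 0 \<le> j \<and> 0 \<le> l \<and> 0 \<le> m \<and> 0 \<le> n \<and> i + j + l + m + n \<le> 3"
    by (simp add: UNIV_coord)
qed

lemma coeff_fun_eqI:
  assumes "coeff_fun p = coeff_fun r"
  shows "p = r"
proof (rule pol_eqI)
  fix \<mu>
  have "\<mu> = mk_expo (\<mu> cX) (\<mu> cY) (\<mu> cZ) (\<mu> cW) (\<mu> cQ)" by (rule mk_expo_eqI) simp_all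
  then have "pol_coeff p' \<mu> = coeff_fun p' (\<mu> cX) (\<mu> cY) (\<mu> cZ) (\<mu> cW) (\<mu> cQ)" for p'
    unfolding coeff_fun_def by (rule arg_cong)
  then show "pol_coeff p \<mu> = pol_coeff r \<mu>"
    using assms by simp
qed

text \<open>
  The general charts behind charts 2, 1 and 0, named after the coordinate along which they have
  their pole.
\<close>

interpretation chart_x: chart cX cY cW "Some cQ" None b g for b g
  by standard auto

interpretation chart_y: chart cY cX cZ "Some cQ" "Some cW" b g for b g
  by standard auto

interpretation chart_z: chart cZ cY cQ "Some cW" None b g for b g
  by standard auto

lemma lookup_laur_eval_old_coord_x:
  assumes "tdegree p \<le> 3"
  shows "Poly_Mapping.lookup (laur_eval (chart_x.old_coord b g) p) (mk_expo i j l m n)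
    = subst_yw (const_t b) (const_t g) (coeff_fun p) i j l m n"
proof -
  have "mk_expo k j l m n + chart_x.shift r s = mk_expo k (j + int r) l (m + int s) (n - int r)" for
      k r s
    by (rule mk_expo_eqI) (simp_all add: chart_x.shift_def unit_expo_def)
  then show ?thesis
    using chart_x.lookup_laur_eval_old_coord[OF assms, of b g "mk_expo i j l m n" i]
    by (simp only: mk_expo_upd mk_expo_apply subst_yw_def divided_power_yw_def coeff_fun_def)
qed

lemma lookup_laur_eval_old_coord_z:
  assumes "tdegree p \<le> 3"
  shows "Poly_Mapping.lookup (laur_eval (chart_z.old_coord b g) p) (mk_expo i j l m n)
    = subst_yw (const_t b) (const_t g) (swap (coeff_fun p)) l j i n m"
proof -
  have "mk_expo i j k m n + chart_z.shift r s = mk_expo i (j + int r) k (m - int r) (n + int s)" for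
      k r s
    by (rule mk_expo_eqI) (simp_all add: chart_z.shift_def unit_expo_def)
  then show ?thesis
    using chart_z.lookup_laur_eval_old_coord[OF assms, of b g "mk_expo i j l m n" l]
    by (simp only: mk_expo_upd mk_expo_apply subst_yw_def divided_power_yw_def coeff_fun_def
        swap_def)
qed

lemma lookup_laur_eval_old_coord_y:
  assumes "tdegree p \<le> 3"
  shows "Poly_Mapping.lookup (laur_eval (chart_y.old_coord b 0) p) (mk_expo i j l m n)
    = subst_xz (const_t b) (coeff_fun p) i j l m n"
proof -
  have "mk_expo i k l m n + chart_y.shift r s
      = mk_expo (i + int r) k (l + int s) (m - int s) (n - int r)" for k r s
    by (rule mk_expo_eqI) (simp_all add: chart_y.shift_def unit_expo_def)
  then show ?thesis
    using chart_y.lookup_laur_eval_old_coord[OF assms, of b 0 "mk_expo i j l m n" j]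
    by (simp only: mk_expo_upd mk_expo_apply subst_xz_def divided_power_xz_def coeff_fun_def
        const_t_simps)
qed

text \<open>
  Reading the condition \<open>regular\<close> off coefficient by coefficient turns the hypothesis on a chart
  into the linear conditions on the coefficients of \<open>f\<close>.
\<close>

lemma chart2_regular:
  assumes D: "d_dt_along f D" and P: "polynomial_in_coords D (chart_x.new_coord b g)"
    and deg: "\<And>v. tdegree (f v) \<le> 3"
  shows "regular_along_x (const_t b) (const_t g)
    (coeff_fun (f cX)) (coeff_fun (f cY)) (coeff_fun (f cZ)) (coeff_fun (f cW)) (coeff_fun (f cQ))"
  unfolding regular_along_x_def
proof (intro allI impI)
  fix i j l m n :: int
  assume i: "i < 0"
  note reg = chart_x.regular[OF D P, of "mk_expo i j l m n", simplified, OF i, unfolded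
      lookup_minus]
  note pole = chart_x.lookup_pole_mult[of b g _
      "mk_expo i j l m n" i, unfolded mk_expo_upd pole_op_def]
    chart_x.lookup_pole_deriv_mult[of b g _ _ "mk_expo i j l m n" i, unfolded mk_expo_upd]
  show "subst_yw (const_t b) (const_t g) (coeff_fun (f cX)) i j l m n = 0 \<and>
    subst_yw (const_t b) (const_t g) (coeff_fun (f cZ)) i j l m n = 0 \<and>
    subst_yw (const_t b) (const_t g) (coeff_fun (f cQ)) i j l m n = 0 \<and>
    subst_yw (const_t b) (const_t g) (coeff_fun (f cW)) i j l m n
      + (const_t b * subst_yw (const_t b) (const_t g) (coeff_fun (f cX)) (i + 2) j l m n
         + 2 * const_t g * subst_yw (const_t b) (const_t g) (coeff_fun (f cX)) (i + 3) j l m n)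
             = 0 \<and>
    subst_yw (const_t b) (const_t g) (coeff_fun (f cY)) i j l m n
      - (const_t b * subst_yw (const_t b) (const_t g) (coeff_fun (f cQ)) (i + 1) j l m n
         + const_t g * subst_yw (const_t b) (const_t g) (coeff_fun (f cQ)) (i + 2) j l m n)
      + (const_t b * subst_yw (const_t b) (const_t g) (coeff_fun (f cX)) (i + 2) j l m (n - 1)
         + 2 * const_t g * subst_yw (const_t b) (const_t g) (coeff_fun (f cX)) (i + 3) j l m (n
             - 1)) = 0"
    using reg[of cX] reg[of cZ] reg[of cQ] reg[of cW] reg[of cY]
    by (simp add: chart_x.slope_deriv_def chart_x.slope_laur_def laur_eval_0 pole
        lookup_laur_eval_old_coord_x[OF deg] mk_expo_minus_unit)
qed

lemma chart0_regular:
  assumes D: "d_dt_along f D" and P: "polynomial_in_coords D (chart_z.new_coord b g)"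
    and deg: "\<And>v. tdegree (f v) \<le> 3"
  shows "regular_along_x (const_t b) (const_t g) (swap (coeff_fun (f cZ))) (swap (coeff_fun (f cY)))
    (swap (coeff_fun (f cX))) (swap (coeff_fun (f cQ))) (swap (coeff_fun (f cW)))"
  unfolding regular_along_x_def
proof (intro allI impI)
  fix l j i n m :: int
  assume l: "l < 0"
  note reg = chart_z.regular[OF D P, of "mk_expo i j l m n", simplified, OF l, unfolded
      lookup_minus]
  note pole = chart_z.lookup_pole_mult[of b g _
      "mk_expo i j l m n" l, unfolded mk_expo_upd pole_op_def]
    chart_z.lookup_pole_deriv_mult[of b g _ _ "mk_expo i j l m n" l, unfolded mk_expo_upd]
  let ?T = "\<lambda>v. subst_yw (const_t b) (const_t g) (swap (coeff_fun (f v)))"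
  show "?T cZ l j i n m = 0 \<and> ?T cX l j i n m = 0 \<and> ?T cW l j i n m = 0 \<and>
    ?T cQ l j i n m + (const_t b * ?T cZ (l + 2) j i n m + 2 * const_t g * ?T cZ (l + 3) j i n m)
        = 0 \<and>
    ?T cY l j i n m - (const_t b * ?T cW (l + 1) j i n m + const_t g * ?T cW (l + 2) j i n m)
      + (const_t b * ?T cZ (l + 2) j i n (m - 1) + 2 * const_t g * ?T cZ (l + 3) j i n (m - 1)) = 0"
    using reg[of cX] reg[of cZ] reg[of cQ] reg[of cW] reg[of cY]
    by (simp add: chart_z.slope_deriv_def chart_z.slope_laur_def laur_eval_0 pole
        lookup_laur_eval_old_coord_z[OF deg] mk_expo_minus_unit)
qed

lemma chart1_regular:
  assumes D: "d_dt_along f D" and P: "polynomial_in_coords D (chart_y.new_coord b 0)"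
    and deg: "\<And>v. tdegree (f v) \<le> 3"
  shows "regular_along_y (const_t b)
    (coeff_fun (f cX)) (coeff_fun (f cY)) (coeff_fun (f cZ)) (coeff_fun (f cW)) (coeff_fun (f cQ))"
  unfolding regular_along_y_def
proof (intro allI impI)
  fix i j l m n :: int
  assume j: "j < 0"
  note reg = chart_y.regular[OF D P, of "mk_expo i j l m n", simplified, OF j, unfolded
      lookup_minus]
  note pole = chart_y.lookup_pole_mult[of b 0 _
      "mk_expo i j l m n" j, unfolded mk_expo_upd pole_op_def]
    chart_y.lookup_pole_deriv_mult[of b 0 _ _ "mk_expo i j l m n" j, unfolded mk_expo_upd]
  let ?T = "\<lambda>v. subst_xz (const_t b) (coeff_fun (f v))"
  show "?T cY i j l m n = 0 \<and> ?T cW i j l m n = 0 \<and> ?T cQ i j l m n = 0 \<and>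
    ?T cX i j l m n - const_t b * ?T cQ i (j + 1) l m n + const_t b * ?T cY i (j + 2) l m (n - 1)
        = 0 \<and>
    ?T cZ i j l m n - const_t b * ?T cW i (j + 1) l m n + const_t b * ?T cY i (j + 2) l (m - 1) n
        = 0"
    using reg[of cX] reg[of cZ] reg[of cQ] reg[of cW] reg[of cY]
    by (simp add: chart_y.slope_deriv_def chart_y.slope_laur_def laur_eval_0 pole
        lookup_laur_eval_old_coord_y[OF deg] mk_expo_minus_unit const_t_simps)
qed

lemma coords0_eq: "coords0 \<alpha>\<^sub>0 \<eta> = chart_z.new_coord (2 * \<alpha>\<^sub>0) (- \<eta>)"
proof
  fix v
  have "rc (- \<eta>) = - rc \<eta>" by (simp add: const_t_simps Const_simps to_ratfun_simps)
  then show "coords0 \<alpha>\<^sub>0 \<eta> v = chart_z.new_coord (2 * \<alpha>\<^sub>0) (- \<eta>) v"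
    by (cases v) (simp_all add: chart_z.new_coord_def chart_z.pole_rat_def chart_z.slope_def
        to_ratfun_simps algebra_simps)
qed

lemma coords1_eq: "coords1 \<alpha>\<^sub>1 = chart_y.new_coord (- \<alpha>\<^sub>1) 0"
proof
  fix v
  show "coords1 \<alpha>\<^sub>1 v = chart_y.new_coord (- \<alpha>\<^sub>1) 0 v"
    by (cases v) (simp_all add: chart_y.new_coord_def chart_y.pole_rat_def chart_y.slope_def
        const_t_simps Const_simps to_ratfun_simps)
qed

lemma coords2_eq: "coords2 \<alpha>\<^sub>2 = chart_x.new_coord (2 * \<alpha>\<^sub>2) 1"
proof
  fix v
  have "rc 1 = 1" by (simp add: const_t_simps Const_simps to_ratfun_simps)
  then show "coords2 \<alpha>\<^sub>2 v = chart_x.new_coord (2 * \<alpha>\<^sub>2) 1 v"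
    by (cases v) (simp_all add: chart_x.new_coord_def chart_x.pole_rat_def chart_x.slope_def
        to_ratfun_simps algebra_simps)
qed

definition pol_term :: "ratt \<Rightarrow> nat \<Rightarrow> nat \<Rightarrow> nat \<Rightarrow> nat \<Rightarrow> nat \<Rightarrow> pol" where
  "pol_term t i j l m n = Const t * Var cX ^ i * Var cY ^ j * Var cZ ^ l * Var cW ^ m * Var cQ ^ n"

lemma Var_power: "Var v ^ n = Poly_Mapping.single (Poly_Mapping.single v n) 1"
  by (induction n) (simp_all add: Var_def mult_single flip: single_add)

lemma coeff_fun_pol_term: "coeff_fun (pol_term t i j l m n)
    = single_coeff t (int i, int j, int l, int m, int n)"
proof (intro ext)
  fix i' j' l' m' n'
  let ?e = "Poly_Mapping.single cX i + Poly_Mapping.single cY j + Poly_Mapping.single cZ l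
    + Poly_Mapping.single cW m + Poly_Mapping.single cQ n"
  have "pol_term t i j l m n = Poly_Mapping.single ?e t"
    by (simp add: pol_term_def Const_def Var_power mult_single)
  moreover have "?e = Abs_poly_mapping (\<lambda>v. nat (mk_expo i' j' l' m' n' v))
      \<longleftrightarrow> i = nat i' \<and> j = nat j' \<and> l = nat l' \<and> m = nat m' \<and> n = nat n'" (is "?L \<longleftrightarrow> ?R")
  proof
    assume ?L
    then have "Poly_Mapping.lookup ?e v = nat (mk_expo i' j' l' m' n' v)" for v by simp
    from this[of cX] this[of cY] this[of cZ] this[of cW] this[of cQ]
    show ?R by (simp add: lookup_add lookup_single)
  next
    assume R: ?R
    show ?L
    proof (rule poly_mapping_eqI)
      fix v show "Poly_Mapping.lookup ?e v = Poly_Mapping.lookup (Abs_poly_mapping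
          (\<lambda>v. nat (mk_expo i' j' l' m' n' v))) v"
        using R by (cases v) (simp_all add: lookup_add lookup_single)
    qed
  qed
  moreover have "(\<forall>v. 0 \<le> mk_expo i' j' l' m' n' v) \<longleftrightarrow> 0 \<le> i' \<and> 0 \<le> j' \<and> 0 \<le> l' \<and> 0 \<le> m' \<and> 0 \<le> n'"
    by (metis coord.exhaust mk_expo_apply)
  ultimately show "coeff_fun (pol_term t i j l m n) i' j' l' m' n'
      = single_coeff t (int i, int j, int l, int m, int n) i' j' l' m' n'"
    by (auto simp: coeff_fun_def pol_coeff_def lookup_single when_def single_coeff_def)
qed

lemma coeff_fun_add: "coeff_fun (p + r) = (\<lambda>i j l m n. coeff_fun p i j l m n
    + coeff_fun r i j l m n)"
  by (simp add: coeff_fun_def pol_coeff_def lookup_add fun_eq_iff)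

section \<open>Uniqueness of the system\<close>

theorem theorem2p1:
  fixes \<alpha>\<^sub>0 \<alpha>\<^sub>1 \<alpha>\<^sub>2 \<eta> :: complex
    and f :: "coord \<Rightarrow> pol"
    and D :: "ratfun \<Rightarrow> ratfun"
  defines "C \<equiv> \<lambda>a. Const (const_t a)"
    and "x \<equiv> Var cX" and "y \<equiv> Var cY" and "z \<equiv> Var cZ" and "w \<equiv> Var cW" and "q \<equiv> Var cQ"
  assumes "\<alpha>\<^sub>0 + \<alpha>\<^sub>1 + \<alpha>\<^sub>2 = 1"
    and "\<alpha>\<^sub>1 \<noteq> 0" and "\<eta> \<noteq> 0"
    and "d_dt_along f D"
    and A1: "\<And>v. tdegree (f v) = 3"
    and A2: "polynomial_in_coords D (coords0 \<alpha>\<^sub>0 \<eta>)"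
      "polynomial_in_coords D (coords1 \<alpha>\<^sub>1)"
      "polynomial_in_coords D (coords2 \<alpha>\<^sub>2)"
  shows "\<exists>c :: ratt. c \<noteq> 0 \<and>
    f cX = Const c * (- (x * w - C \<alpha>\<^sub>2) * x + C (1 / 2)) \<and>
    f cY = Const c * ((x * w + z * q - 1) * y + C \<alpha>\<^sub>1 * w * q) \<and>
    f cZ = Const c * (- (z * q - C \<alpha>\<^sub>0) * z - C (\<eta> / 2)) \<and>
    f cW = Const c * ((x * w - z * q - C \<alpha>\<^sub>2) * w + y * z) \<and>
    f cQ = Const c * ((z * q - x * w - C \<alpha>\<^sub>0) * q + x * y)"
proof -
  have deg: "tdegree (f v) \<le> 3" for v by (simp add: A1)
  interpret regular_cubic_system "const_t (2 * \<alpha>\<^sub>0)" "const_t (- \<eta>)" "const_t (2 * \<alpha>\<^sub>2)" "const_t 1"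
      "const_t (- \<alpha>\<^sub>1)"
    "coeff_fun (f cX)" "coeff_fun (f cY)" "coeff_fun (f cZ)" "coeff_fun (f cW)" "coeff_fun (f cQ)"
    using assms(8-10) A2[unfolded coords0_eq coords1_eq coords2_eq]
    by unfold_locales (simp_all add: cubic_coeff_fun deg const_t_eq_0_iff chart2_regular
        chart0_regular chart1_regular)
  obtain k where k:
    "f cX = pol_term (- k) 2 0 0 1 0 + pol_term (k * const_t (2 * \<alpha>\<^sub>2) / 2) 1 0 0 0 0
        + pol_term (k * const_t 1 / 2) 0 0 0 0 0"
    "f cY = pol_term k 1 1 0 1 0 + pol_term k 0 1 1 0 1
      + pol_term (- (k * (const_t (2 * \<alpha>\<^sub>0) / 2 - const_t (- \<alpha>\<^sub>1)
          + const_t (2 * \<alpha>\<^sub>2) / 2))) 0 1 0 0 0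
      + pol_term (- (k * const_t (- \<alpha>\<^sub>1))) 0 0 0 1 1"
    "f cZ = pol_term (- k) 0 0 2 0 1 + pol_term (k * const_t (2 * \<alpha>\<^sub>0) / 2) 0 0 1 0 0
        + pol_term (k * const_t (- \<eta>) / 2) 0 0 0 0 0"
    "f cW = pol_term k 1 0 0 2 0 + pol_term (- k) 0 0 1 1 1
        + pol_term (- (k * const_t (2 * \<alpha>\<^sub>2) / 2)) 0 0 0 1 0 + pol_term k 0 1 1 0 0"
    "f cQ = pol_term k 0 0 1 0 2 + pol_term (- k) 1 0 0 1 1
        + pol_term (- (k * const_t (2 * \<alpha>\<^sub>0) / 2)) 0 0 0 0 1 + pol_term k 1 1 0 0 0"
    by (rule coefficients, rule that; rule coeff_fun_eqI; simp add: coeff_fun_add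
        coeff_fun_pol_term)
  have const_half: "const_t (a / 2) = const_t a / 2" for a
    using const_t_simps(3)[of 2 "a / 2"] by (simp add: const_t_numeral)
  have double: "k * const_t (2 * a) / 2 = k * const_t a" "const_t (2 * a) / 2 = const_t a" for a
    by (simp_all add: const_t_simps const_t_numeral)
  have sum: "const_t \<alpha>\<^sub>0 - const_t (- \<alpha>\<^sub>1) + const_t \<alpha>\<^sub>2 = 1"
    using assms(7) by (simp flip: const_t_simps add: algebra_simps)
  have "k \<noteq> 0"
  proof
    assume "k = 0"
    then have "f cX = 0" using k(1) by (simp add: pol_term_def Const_simps)
    then show False using A1[of cX] by (simp add: tdegree_def)
  qed
  moreover have "f cX = Const k * (- (x * w - C \<alpha>\<^sub>2) * x + C (1 / 2))"
    unfolding k(1) x_def w_def C_def const_half double pol_term_def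
    by (simp add: Const_simps power2_eq_square algebra_simps flip: times_divide_eq_right)
  moreover have "f cY = Const k * ((x * w + z * q - 1) * y + C \<alpha>\<^sub>1 * w * q)"
    unfolding k(2) x_def y_def z_def w_def q_def C_def double sum pol_term_def
    by (simp add: Const_simps const_t_simps algebra_simps)
  moreover have "f cZ = Const k * (- (z * q - C \<alpha>\<^sub>0) * z - C (\<eta> / 2))"
    unfolding k(3) z_def q_def C_def const_half double pol_term_def
    by (simp add: Const_simps const_t_simps power2_eq_square algebra_simps
        flip: times_divide_eq_right)
  moreover have "f cW = Const k * ((x * w - z * q - C \<alpha>\<^sub>2) * w + y * z)"
    unfolding k(4) x_def y_def z_def w_def q_def C_def double pol_term_def
    by (simp add: Const_simps power2_eq_square algebra_simps)
  moreover have "f cQ = Const k * ((z * q - x * w - C \<alpha>\<^sub>0) * q + x * y)"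
    unfolding k(5) x_def y_def z_def w_def q_def C_def double pol_term_def
    by (simp add: Const_simps power2_eq_square algebra_simps)
  ultimately show ?thesis by blast
qed

end
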